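(* Let $1\le p<\infty$, and let $L_p(0,\infty)$ be the (real or complex) space of (equivalence classes of) $p$-integrable functions on $(0,\infty)$. Let $w>1$ and $a>0$ be real numbers. Then the weighted left translation $$(T_{w,a}x)(t):=w^{t}x(t+a),\quad t\ge 0,$$ with domain $$D(T_{w,a}):=\left\{x\in L_p(0,\infty) : \int_0^\infty |w^{t}x(t+a)|^p\,dt<\infty\right\}$$ is a chaotic unbounded linear operator in $L_p(0,\infty)$. Furthermore, if the underlying space is complex, then $$\sigma(T_{w,a})=\sigma_p(T_{w,a})=\mathbb{C}.$$
   Context: Let $T$ be a (bounded or unbounded) linear operator in a (real or complex) Banach space $X$ with domain $D(T)$. Powers have their natural domains: $T^0:=I$ is the identity operator and $D(T^{n})=\{x\in D(T^{n-1}) : T^{n-1}x\in D(T)\}$; $C^\infty(T):=\bigcap_{n=0}^\infty D(T^n)$. A nonzero vector $x\in C^\infty(T)$ is hypercyclic for $T$ if its orbit $\{T^nx : n=0,1,2,\dots\}$ is dense in $X$; $T$ is hypercyclic if it has a hypercyclic vector. A vector $x$ is a periodic point of $T$ if there is $N\in\mathbb{N}=\{1,2,\dots\}$ with $x\in D(T^N)$ and $T^Nx=x$. $T$ is chaotic if it is hypercyclic and its set of periodic points is dense in $X$. For a linear operator $T$ in a complex Banach space $X$: the resolvent set $\rho(T)$ is the set of $\lambda\in\mathbb{C}$ such that $T-\lambda I$ has an inverse that is a bounded linear operator defined on all of $X$; the spectrum is $\sigma(T):=\mathbb{C}\setminus\rho(T)$; the point spectrum $\sigma_p(T)$ is the set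 of eigenvalues of $T$ (those $\lambda$ for which $T-\lambda I$ is not injective on $D(T)$). *)

theory Defs
  imports "HOL-Analysis.Analysis"
begin

text \<open>
  Since the exponent of an \<open>L\<^sub>p\<close> space is a term and not a type, the spaces are given by explicit
  carriers. All operator-theoretic notions below are meant for structures that are
  Banach spaces over \<open>'k\<close>, and for operators that are linear in the sense of \<open>linear_operator\<close>.
\<close>

record ('k, 'x) normed_structure =
  vcarrier :: "'x set"
  vzero :: 'x
  vadd :: "'x \<Rightarrow> 'x \<Rightarrow> 'x"
  vscale :: "'k \<Rightarrow> 'x \<Rightarrow> 'x"
  vnorm :: "'x \<Rightarrow> real"

definition vdiff :: "('k::field, 'x) normed_structure \<Rightarrow> 'x \<Rightarrow> 'x \<Rightarrow> 'x" where
  "vdiff X x y = vadd X x (vscale X (- 1) y)"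

definition dense_in :: "('k::field, 'x) normed_structure \<Rightarrow> 'x set \<Rightarrow> bool" where
  "dense_in X S \<longleftrightarrow>
     S \<subseteq> vcarrier X \<and> (\<forall>x\<in>vcarrier X. \<forall>e>0. \<exists>s\<in>S. vnorm X (vdiff X x s) < e)"


text \<open>The values of \<open>app T\<close> outside \<open>dom_of T\<close> are irrelevant.\<close>

record 'x operator =
  dom_of :: "'x set"
  app :: "'x \<Rightarrow> 'x"

definition linear_operator :: "('k::field, 'x) normed_structure \<Rightarrow> 'x operator \<Rightarrow> bool" where
  "linear_operator X T \<longleftrightarrow>
     dom_of T \<subseteq> vcarrier X \<and> vzero X \<in> dom_of T \<and>
     (\<forall>x\<in>dom_of T. app T x \<in> vcarrier X) \<and>
     (\<forall>x\<in>dom_of T. \<forall>y\<in>dom_of T.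
        vadd X x y \<in> dom_of T \<and> app T (vadd X x y) = vadd X (app T x) (app T y)) \<and>
     (\<forall>c. \<forall>x\<in>dom_of T.
        vscale X c x \<in> dom_of T \<and> app T (vscale X c x) = vscale X c (app T x))"

definition bounded_operator :: "('k::field, 'x) normed_structure \<Rightarrow> 'x operator \<Rightarrow> bool" where
  "bounded_operator X T \<longleftrightarrow> (\<exists>C. \<forall>x\<in>dom_of T. vnorm X (app T x) \<le> C * vnorm X x)"

definition unbounded_linear_operator ::
    "('k::field, 'x) normed_structure \<Rightarrow> 'x operator \<Rightarrow> bool" where
  "unbounded_linear_operator X T \<longleftrightarrow> linear_operator X T \<and> \<not> bounded_operator X T"

text \<open>\<open>pow_dom X T n\<close> is the natural domain of the \<open>n\<close>-th power of \<open>T\<close>; on it, that power is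
  \<open>app T ^^ n\<close>.\<close>

primrec pow_dom :: "('k, 'x) normed_structure \<Rightarrow> 'x operator \<Rightarrow> nat \<Rightarrow> 'x set" where
  "pow_dom X T 0 = vcarrier X"
| "pow_dom X T (Suc n) = {x \<in> pow_dom X T n. (app T ^^ n) x \<in> dom_of T}"

definition C_infinity :: "('k, 'x) normed_structure \<Rightarrow> 'x operator \<Rightarrow> 'x set" where
  "C_infinity X T = (\<Inter>n. pow_dom X T n)"

definition hypercyclic_vector ::
    "('k::field, 'x) normed_structure \<Rightarrow> 'x operator \<Rightarrow> 'x \<Rightarrow> bool" where
  "hypercyclic_vector X T x \<longleftrightarrow>
     x \<in> C_infinity X T \<and> x \<noteq> vzero X \<and> dense_in X (range (\<lambda>n. (app T ^^ n) x))"

definition hypercyclic :: "('k::field, 'x) normed_structure \<Rightarrow> 'x operator \<Rightarrow> bool" where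
  "hypercyclic X T \<longleftrightarrow> (\<exists>x. hypercyclic_vector X T x)"

definition periodic_points :: "('k, 'x) normed_structure \<Rightarrow> 'x operator \<Rightarrow> 'x set" where
  "periodic_points X T = {x. \<exists>N\<ge>1. x \<in> pow_dom X T N \<and> (app T ^^ N) x = x}"

definition chaotic :: "('k::field, 'x) normed_structure \<Rightarrow> 'x operator \<Rightarrow> bool" where
  "chaotic X T \<longleftrightarrow> hypercyclic X T \<and> dense_in X (periodic_points X T)"

definition minus_scalar ::
    "('k::field, 'x) normed_structure \<Rightarrow> 'x operator \<Rightarrow> 'k \<Rightarrow> 'x operator" where
  "minus_scalar X T \<mu> = \<lparr>dom_of = dom_of T, app = (\<lambda>x. vdiff X (app T x) (vscale X \<mu> x))\<rparr>"

definition resolvent_set :: "(complex, 'x) normed_structure \<Rightarrow> 'x operator \<Rightarrow> complex set" where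
  "resolvent_set X T = {\<mu>. \<exists>R.
     dom_of R = vcarrier X \<and> linear_operator X R \<and> bounded_operator X R \<and>
     (\<forall>x\<in>dom_of T. app R (app (minus_scalar X T \<mu>) x) = x) \<and>
     (\<forall>y\<in>vcarrier X. app R y \<in> dom_of T \<and> app (minus_scalar X T \<mu>) (app R y) = y)}"

definition spectrum :: "(complex, 'x) normed_structure \<Rightarrow> 'x operator \<Rightarrow> complex set" where
  "spectrum X T = - resolvent_set X T"

definition point_spectrum :: "(complex, 'x) normed_structure \<Rightarrow> 'x operator \<Rightarrow> complex set" where
  "point_spectrum X T = {\<mu>. \<not> inj_on (app (minus_scalar X T \<mu>)) (dom_of T)}"


text \<open>Elements of \<open>L\<^sub>p\<close> are genuine classes of measurable functions modulo equality almost
  everywhere; \<open>rep\<close> picks a representative.\<close>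

definition ae_class :: "'m measure \<Rightarrow> ('m \<Rightarrow> 'k::real_normed_vector) \<Rightarrow> ('m \<Rightarrow> 'k) set" where
  "ae_class M f = {g \<in> borel_measurable M. AE t in M. g t = f t}"

definition rep :: "('m \<Rightarrow> 'k) set \<Rightarrow> 'm \<Rightarrow> 'k" where
  "rep F = (SOME f. f \<in> F)"

definition Lp_space ::
    "'m measure \<Rightarrow> real \<Rightarrow> ('k::real_normed_field, ('m \<Rightarrow> 'k) set) normed_structure" where
  "Lp_space M p =
     \<lparr>vcarrier =
        ae_class M ` {f \<in> borel_measurable M. integrable M (\<lambda>t. norm (f t) powr p)},
      vzero = ae_class M (\<lambda>t. 0),
      vadd = (\<lambda>F G. ae_class M (\<lambda>t. rep F t + rep G t)),
      vscale = (\<lambda>c F. ae_class M (\<lambda>t. c * rep F t)),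
      vnorm = (\<lambda>F. (LINT t|M. norm (rep F t) powr p) powr (1 / p))\<rparr>"

abbreviation half_line :: "real measure" where
  "half_line \<equiv> lebesgue_on {0<..}"

abbreviation Lp_real :: "real \<Rightarrow> (real, (real \<Rightarrow> real) set) normed_structure" where
  "Lp_real p \<equiv> Lp_space half_line p"

abbreviation Lp_complex :: "real \<Rightarrow> (complex, (real \<Rightarrow> complex) set) normed_structure" where
  "Lp_complex p \<equiv> Lp_space half_line p"

definition translate_fun :: "real \<Rightarrow> real \<Rightarrow> (real \<Rightarrow> 'k::real_normed_field) \<Rightarrow> real \<Rightarrow> 'k" where
  "translate_fun w a x = (\<lambda>t. of_real (w powr t) * x (t + a))"

definition weighted_translation ::
    "real \<Rightarrow> real \<Rightarrow> real \<Rightarrow> (real \<Rightarrow> 'k::real_normed_field) set operator" where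
  "weighted_translation p w a =
     \<lparr>dom_of = {F \<in> vcarrier (Lp_space half_line p).
        integrable half_line (\<lambda>t. norm (translate_fun w a (rep F) t) powr p)},
      app = (\<lambda>F. ae_class half_line (translate_fun w a (rep F)))\<rparr>"


text \<open>The lemmas below show that nothing above depends on the choice made by \<open>rep\<close>.\<close>

lemma rep_ae_class:
  assumes "f \<in> borel_measurable M"
  shows "rep (ae_class M f) \<in> borel_measurable M" "AE t in M. rep (ae_class M f) t = f t"
proof -
  have "f \<in> ae_class M f" using assms by (simp add: ae_class_def)
  then have "rep (ae_class M f) \<in> ae_class M f" unfolding rep_def by (rule someI[where P = "\<lambda>g. g \<in> ae_class M f"])
  then show "rep (ae_class M f) \<in> borel_measurable M" "AE t in M. rep (ae_class M f) t = f t"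
    by (auto simp: ae_class_def)
qed

lemma ae_class_cong:
  assumes "AE t in M. f t = g t"
  shows "ae_class M f = ae_class M g"
proof -
  have "(AE t in M. h t = f t) \<longleftrightarrow> (AE t in M. h t = g t)" for h
    using assms by (auto elim: eventually_elim2)
  then show ?thesis by (simp add: ae_class_def)
qed

lemma ae_class_eq_iff:
  assumes "f \<in> borel_measurable M"
  shows "ae_class M f = ae_class M g \<longleftrightarrow> (AE t in M. f t = g t)"
proof
  assume "ae_class M f = ae_class M g"
  moreover have "f \<in> ae_class M f" using assms by (simp add: ae_class_def)
  ultimately show "AE t in M. f t = g t" by (auto simp: ae_class_def)
qed (rule ae_class_cong)

lemma Lp_space_on_classes:
  fixes f g :: "'m \<Rightarrow> 'k::{real_normed_field, second_countable_topology}"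
  assumes f: "f \<in> borel_measurable M" and g: "g \<in> borel_measurable M"
  shows "vadd (Lp_space M p) (ae_class M f) (ae_class M g) = ae_class M (\<lambda>t. f t + g t)"
    and "vscale (Lp_space M p) c (ae_class M f) = ae_class M (\<lambda>t. c * f t)"
    and "vnorm (Lp_space M p) (ae_class M f) = (LINT t|M. norm (f t) powr p) powr (1 / p)"
proof -
  note r = rep_ae_class[OF f] rep_ae_class[OF g]
  show "vadd (Lp_space M p) (ae_class M f) (ae_class M g) = ae_class M (\<lambda>t. f t + g t)"
    unfolding Lp_space_def using r(2,4)
    by (auto intro!: ae_class_cong elim: eventually_elim2)
  show "vscale (Lp_space M p) c (ae_class M f) = ae_class M (\<lambda>t. c * f t)"
    unfolding Lp_space_def using r(2) by (auto intro!: ae_class_cong elim: eventually_mono)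
  have [measurable]: "f \<in> borel_measurable M" "rep (ae_class M f) \<in> borel_measurable M"
    using f r by auto
  have "(LINT t|M. norm (rep (ae_class M f) t) powr p) = (LINT t|M. norm (f t) powr p)"
    by (rule integral_cong_AE) (use r(2) in \<open>auto elim: eventually_mono\<close>)
  then show "vnorm (Lp_space M p) (ae_class M f) = (LINT t|M. norm (f t) powr p) powr (1 / p)"
    by (simp add: Lp_space_def)
qed

lemma AE_half_line_translate:
  assumes "AE t in half_line. P t" and "a \<ge> 0"
  shows "AE t in half_line. P (t + a)"
proof -
  have "AE t in lebesgue. t > 0 \<longrightarrow> P t"
    using assms(1) by (simp add: AE_restrict_space_iff)
  then obtain N where N: "N \<in> null_sets lebesgue" "{t. \<not> (t > 0 \<longrightarrow> P t)} \<subseteq> N"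
    by (auto simp: eventually_ae_filter)
  have "negligible ((+) (- a) ` N)"
    by (rule negligible_translation) (simp add: negligible_iff_null_sets N(1))
  moreover have "{t. \<not> (t > 0 \<longrightarrow> P (t + a))} \<subseteq> (+) (- a) ` N"
  proof
    fix t assume "t \<in> {t. \<not> (t > 0 \<longrightarrow> P (t + a))}"
    then have "t + a \<in> N" using N(2) assms(2) by auto
    then show "t \<in> (+) (- a) ` N" by (intro image_eqI[of _ _ "t + a"]) auto
  qed
  ultimately have "AE t in lebesgue. t > 0 \<longrightarrow> P (t + a)"
    by (auto simp: eventually_ae_filter negligible_iff_null_sets)
  then show ?thesis by (simp add: AE_restrict_space_iff)
qed

lemma weighted_translation_on_classes:
  fixes f :: "real \<Rightarrow> 'k::real_normed_field"
  assumes "f \<in> borel_measurable half_line" and "a > 0"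
  shows "app (weighted_translation p w a) (ae_class half_line f)
    = ae_class half_line (translate_fun w a f)"
proof -
  have "AE t in half_line. rep (ae_class half_line f) (t + a) = f (t + a)"
    by (rule AE_half_line_translate) (use rep_ae_class(2)[OF assms(1)] assms(2) in auto)
  then show ?thesis
    unfolding weighted_translation_def translate_fun_def
    by (auto intro!: ae_class_cong elim: eventually_mono)
qed

end

theory Submission
  imports Defs
begin

text \<open>
  Multiplication by the Gaussian \<open>v(t) = w powr (t/2 - t\<^sup>2/(2a))\<close> turns the weighted translation into
  the plain one: since \<open>w\<^sup>t v(t + a) = v(t)\<close>, the operator \<open>T\<close> maps \<open>v g\<close> to \<open>v g(\<cdot> + a)\<close>
  (\<open>weighted_translation_gauss_mult\<close>). The weight \<open>v\<close> decays faster than every exponential, so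
  \<open>v g\<close> lies in \<open>L\<^sub>p\<close>, together with all its iterates under \<open>T\<close>, as soon as \<open>g\<close> has at most
  exponential growth. Every assertion thereby becomes one about ordinary translates.
  
  \<^item> Eigenvectors: \<open>g = exp(\<alpha> t)\<close> belongs to the eigenvalue \<open>exp(\<alpha> a)\<close>, which can be any nonzero number
    of the complex plane, and the indicator function of \<open>(0, a]\<close> belongs to \<open>0\<close>. Hence the point
    spectrum, and with it the spectrum, is everything; already the real positive eigenvalues are
    arbitrarily large, so \<open>T\<close> is unbounded.
  
  \<^item> Density: the products \<open>v s\<close> of \<open>v\<close> with step functions \<open>s\<close> taken from one countable family are
    dense in \<open>L\<^sub>p\<close> (\<open>gauss_mult_step_fun_dense\<close>). It therefore suffices to approximate those.
  
  \<^item> Periodic points: if \<open>g\<close> has period \<open>N a\<close> then \<open>v g\<close> is a periodic point. Restricting \<open>s\<close> to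
    \<open>(0, N a)\<close> and continuing periodically gives functions that agree with \<open>s\<close> on longer and longer
    intervals, with a common bound.
  
  \<^item> Hypercyclic vector: \<open>v G\<close>, where \<open>G\<close> carries on the block \<open>(2\<^sup>k a, 2\<^sup>k\<^sup>+\<^sup>1 a)\<close> a copy of the \<open>k\<close>-th
    function of a list in which every \<open>s\<close> occurs infinitely often. Translating by \<open>2\<^sup>k a\<close> moves this
    copy to the origin. The blocks are so long that \<open>G\<close> can be kept below \<open>t/a\<close>, and the part of the
    translate beyond the block is then at most \<open>2t/a\<close>, a bound that is independent of \<open>k\<close>.
  
  In both approximation arguments the functions converge pointwise below an exponential bound, and
  \<open>gauss_mult_dominated_convergence\<close> gives convergence in \<open>L\<^sub>p\<close>.
\<close>

section \<open>Functions with integrable p-th power\<close>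

definition p_integrable :: "'m measure \<Rightarrow> real \<Rightarrow> ('m \<Rightarrow> 'k::real_normed_vector) \<Rightarrow> bool" where
  "p_integrable M p f \<longleftrightarrow> f \<in> borel_measurable M \<and> integrable M (\<lambda>t. norm (f t) powr p)"

text \<open>
  Replaces the triangle inequality of \<open>L\<^sub>p\<close>: a constant in front of the \<open>p\<close>-th powers is harmless where
  only closure under sums and convergence to zero matter.
\<close>

lemma norm_add_powr_le:
  fixes x y :: "'k::real_normed_vector"
  assumes "p \<ge> 0"
  shows "norm (x + y) powr p \<le> 2 powr p * (norm x powr p + norm y powr p)"
proof -
  have "norm (x + y) \<le> 2 * max (norm x) (norm y)"
    by (rule order_trans[OF norm_triangle_ineq]) simp
  then have "norm (x + y) powr p \<le> (2 * max (norm x) (norm y)) powr p"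
    using assms by (intro powr_mono2) auto
  also have "\<dots> = 2 powr p * max (norm x) (norm y) powr p"
    by (rule powr_mult)
  also have "\<dots> \<le> 2 powr p * (norm x powr p + norm y powr p)"
    by (intro mult_left_mono) (auto simp: max_def)
  finally show ?thesis .
qed

lemma p_integrable_bound:
  assumes "g \<in> borel_measurable M" "p_integrable M p f" "p \<ge> 0"
    and "AE t in M. norm (g t) \<le> norm (f t)"
  shows "p_integrable M p g"
  unfolding p_integrable_def
proof
  have [measurable]: "g \<in> borel_measurable M" by fact
  show "integrable M (\<lambda>t. norm (g t) powr p)"
  proof (rule Bochner_Integration.integrable_bound)
    show "integrable M (\<lambda>t. norm (f t) powr p)"
      using assms(2) by (simp add: p_integrable_def)
    show "AE t in M. norm (norm (g t) powr p) \<le> norm (norm (f t) powr p)"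
      using assms(4) by eventually_elim (use assms(3) in \<open>auto intro!: powr_mono2\<close>)
  qed measurable
qed fact

lemma p_integrable_add:
  fixes f g :: "'m \<Rightarrow> 'k::{real_normed_field, second_countable_topology}"
  assumes f: "p_integrable M p f" and g: "p_integrable M p g" and "p \<ge> 0"
  shows "p_integrable M p (\<lambda>t. f t + g t)"
  unfolding p_integrable_def
proof
  have [measurable]: "f \<in> borel_measurable M" "g \<in> borel_measurable M"
    using f g by (auto simp: p_integrable_def)
  show "(\<lambda>t. f t + g t) \<in> borel_measurable M" by measurable
  show "integrable M (\<lambda>t. norm (f t + g t) powr p)"
  proof (rule Bochner_Integration.integrable_bound)
    show "integrable M (\<lambda>t. 2 powr p * (norm (f t) powr p + norm (g t) powr p))"
      using f g by (auto simp: p_integrable_def)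
    show "AE t in M. norm (norm (f t + g t) powr p)
        \<le> norm (2 powr p * (norm (f t) powr p + norm (g t) powr p))"
      by (intro AE_I2) (use norm_add_powr_le[OF \<open>p \<ge> 0\<close>] in simp)
  qed measurable
qed

lemma p_integrable_scale:
  fixes f :: "'m \<Rightarrow> 'k::{real_normed_field, second_countable_topology}"
  assumes "p_integrable M p f"
  shows "p_integrable M p (\<lambda>t. c * f t)"
proof -
  have [measurable]: "f \<in> borel_measurable M" using assms by (simp add: p_integrable_def)
  show ?thesis using assms by (simp add: p_integrable_def norm_mult powr_mult)
qed

lemma p_integrable_cong_AE:
  fixes f g :: "'m \<Rightarrow> 'k::real_normed_vector"
  assumes "f \<in> borel_measurable M" "g \<in> borel_measurable M" "AE t in M. f t = g t"
  shows "p_integrable M p f \<longleftrightarrow> p_integrable M p g"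
proof -
  have [measurable]: "f \<in> borel_measurable M" "g \<in> borel_measurable M" by fact+
  have "integrable M (\<lambda>t. norm (f t) powr p) \<longleftrightarrow> integrable M (\<lambda>t. norm (g t) powr p)"
    by (rule integrable_cong_AE) (use assms(3) in \<open>auto elim: eventually_mono\<close>)
  then show ?thesis using assms by (simp add: p_integrable_def)
qed

lemma Lp_dominated_convergence:
  fixes f :: "nat \<Rightarrow> 'm \<Rightarrow> 'k::{real_normed_field, second_countable_topology}"
  assumes "p > 0"
    and fm: "\<And>n. f n \<in> borel_measurable M" and gm: "g \<in> borel_measurable M"
    and b: "p_integrable M p b"
    and dom: "\<And>n. AE t in M. norm (f n t - g t) \<le> norm (b t)"
    and lim: "AE t in M. (\<lambda>n. f n t) \<longlonglongrightarrow> g t"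
  shows "(\<lambda>n. LINT t|M. norm (f n t - g t) powr p) \<longlonglongrightarrow> 0"
proof -
  note [measurable] = fm gm
  have "(\<lambda>n. LINT t|M. norm (f n t - g t) powr p) \<longlonglongrightarrow> (LINT t|M. 0)"
  proof (rule integral_dominated_convergence)
    show "integrable M (\<lambda>t. norm (b t) powr p)" using b by (simp add: p_integrable_def)
    show "AE t in M. (\<lambda>n. norm (f n t - g t) powr p) \<longlonglongrightarrow> 0"
      using lim
    proof eventually_elim
      fix t assume "(\<lambda>n. f n t) \<longlonglongrightarrow> g t"
      then have "(\<lambda>n. norm (f n t - g t)) \<longlonglongrightarrow> 0"
        by (simp add: LIM_zero tendsto_norm_zero)
      then show "(\<lambda>n. norm (f n t - g t) powr p) \<longlonglongrightarrow> 0"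
        using tendsto_powr'[OF _ tendsto_const, of "\<lambda>n. norm (f n t - g t)" 0 sequentially p] assms(1)
        by auto
    qed
    show "AE t in M. norm (norm (f n t - g t) powr p) \<le> norm (b t) powr p" for n
      using dom[of n] by eventually_elim (use assms(1) in \<open>auto intro!: powr_mono2\<close>)
  qed measurable
  then show ?thesis by simp
qed

text \<open>
  A limit of functions \<open>h n\<close> that is close enough to \<open>f\<close> can be replaced by one of the \<open>h n\<close>; the factor
  \<open>2 powr p\<close> is the constant of the quasi-triangle inequality.
\<close>

lemma Lp_approx_trans:
  fixes f g :: "'m \<Rightarrow> 'k::{real_normed_field, second_countable_topology}"
  assumes p: "p > 0" and "e > 0" and f: "p_integrable M p f" and g: "p_integrable M p g"
    and h: "\<And>n. p_integrable M p (h n)"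
    and fg: "(LINT t|M. norm (f t - g t) powr p) < e / (2 * 2 powr p)"
    and hg: "(\<lambda>n. LINT t|M. norm (h n t - g t) powr p) \<longlonglongrightarrow> 0"
  obtains n where "(LINT t|M. norm (f t - h n t) powr p) < e"
proof -
  have pos: "e / (2 * 2 powr p) > 0" using \<open>e > 0\<close> by simp
  obtain n where n: "(LINT t|M. norm (h n t - g t) powr p) < e / (2 * 2 powr p)"
    using order_tendstoD(2)[OF hg pos] by (auto simp: eventually_sequentially)
  have sub: "integrable M (\<lambda>t. norm (x t - y t) powr p)"
    if "p_integrable M p x" "p_integrable M p y" for x y :: "'m \<Rightarrow> 'k"
    using p_integrable_add[OF that(1) p_integrable_scale[OF that(2), of "-1"]] p
    by (simp add: p_integrable_def)
  have "(LINT t|M. norm (f t - h n t) powr p)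
      \<le> (LINT t|M. 2 powr p * (norm (f t - g t) powr p + norm (h n t - g t) powr p))"
  proof (rule integral_mono)
    show "norm (f t - h n t) powr p
        \<le> 2 powr p * (norm (f t - g t) powr p + norm (h n t - g t) powr p)" for t
      using norm_add_powr_le[of p "f t - g t" "g t - h n t"] p by (simp add: norm_minus_commute)
  qed (use sub f g h in auto)
  also have "\<dots> = 2 powr p * ((LINT t|M. norm (f t - g t) powr p)
      + (LINT t|M. norm (h n t - g t) powr p))"
    using sub f g h by simp
  also have "\<dots> < 2 powr p * (e / (2 * 2 powr p) + e / (2 * 2 powr p))"
    using fg n by (intro mult_strict_left_mono add_strict_mono) auto
  also have "\<dots> = e" by simp
  finally show ?thesis by (rule that)
qed

section \<open>The space of classes\<close>

lemma Lp_carrier_iff: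
  assumes "f \<in> borel_measurable M"
  shows "ae_class M f \<in> vcarrier (Lp_space M p) \<longleftrightarrow> p_integrable M p f"
proof
  assume "ae_class M f \<in> vcarrier (Lp_space M p)"
  then obtain g where g: "p_integrable M p g" "ae_class M f = ae_class M g"
    by (auto simp: Lp_space_def p_integrable_def)
  have "AE t in M. f t = g t" using g(2) assms by (simp add: ae_class_eq_iff)
  then show "p_integrable M p f"
    using p_integrable_cong_AE[OF assms, of g] g(1) by (auto simp: p_integrable_def)
qed (auto simp: Lp_space_def p_integrable_def)

lemma Lp_carrierE:
  assumes "F \<in> vcarrier (Lp_space M p)"
  obtains f where "p_integrable M p f" "F = ae_class M f"
  using assms by (auto simp: Lp_space_def p_integrable_def)

lemmas vscale_on_classes =
    Lp_space_on_classes(2)[where g = "\<lambda>_. 0", OF _ borel_measurable_const]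
  and vnorm_on_classes =
    Lp_space_on_classes(3)[where g = "\<lambda>_. 0", OF _ borel_measurable_const]

lemma vdiff_on_classes:
  fixes f g :: "'m \<Rightarrow> 'k::{real_normed_field, second_countable_topology}"
  assumes [measurable]: "f \<in> borel_measurable M" "g \<in> borel_measurable M"
  shows "vdiff (Lp_space M p) (ae_class M f) (ae_class M g) = ae_class M (\<lambda>t. f t - g t)"
  by (simp add: vdiff_def vscale_on_classes Lp_space_on_classes(1))

lemma vnorm_eq_0_iff_AE:
  fixes f :: "'m \<Rightarrow> 'k::{real_normed_field, second_countable_topology}"
  assumes "p_integrable M p f"
  shows "vnorm (Lp_space M p) (ae_class M f) = 0 \<longleftrightarrow> (AE t in M. f t = 0)"
proof -
  have "f \<in> borel_measurable M" "integrable M (\<lambda>t. norm (f t) powr p)"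
    using assms by (auto simp: p_integrable_def)
  then show ?thesis
    by (simp add: vnorm_on_classes integral_nonneg_eq_0_iff_AE)
qed

lemma vnorm_vscale:
  fixes f :: "'m \<Rightarrow> 'k::{real_normed_field, second_countable_topology}"
  assumes "p > 0" "f \<in> borel_measurable M"
  shows "vnorm (Lp_space M p) (vscale (Lp_space M p) c (ae_class M f)) =
    norm c * vnorm (Lp_space M p) (ae_class M f)"
proof -
  have [measurable]: "f \<in> borel_measurable M" by fact
  have "(\<lambda>t. c * f t) \<in> borel_measurable M" by measurable
  then show ?thesis
    using assms by (simp add: vscale_on_classes vnorm_on_classes norm_mult powr_mult powr_powr)
qed

text \<open>
  The root in the norm is monotone and can be absorbed into the arbitrary bound, so only \<open>p\<close>-th powers of
  distances between representatives have to be estimated.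
\<close>

lemma dense_in_LpI:
  fixes S :: "('m \<Rightarrow> 'k::{real_normed_field, second_countable_topology}) set set"
  assumes "p > 0" "S \<subseteq> vcarrier (Lp_space M p)"
    and approx: "\<And>f e. p_integrable M p f \<Longrightarrow> e > 0 \<Longrightarrow>
      \<exists>g\<in>borel_measurable M. ae_class M g \<in> S \<and> (LINT t|M. norm (f t - g t) powr p) < e"
  shows "dense_in (Lp_space M p) S"
  unfolding dense_in_def
proof (intro conjI ballI allI impI)
  fix x :: "('m \<Rightarrow> 'k) set" and e assume x: "x \<in> vcarrier (Lp_space M p)" and e: "(e::real) > 0"
  obtain f where f: "p_integrable M p f" "x = ae_class M f"
    using Lp_carrierE[OF x] .
  obtain g where g: "g \<in> borel_measurable M" "ae_class M g \<in> S"
    and less: "(LINT t|M. norm (f t - g t) powr p) < e powr p"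
    using approx[OF f(1), of "e powr p"] e by auto
  have [measurable]: "f \<in> borel_measurable M" "g \<in> borel_measurable M"
    using f(1) g(1) by (simp_all add: p_integrable_def)
  have "vnorm (Lp_space M p) (vdiff (Lp_space M p) x (ae_class M g))
      = (LINT t|M. norm (f t - g t) powr p) powr (1 / p)"
    by (simp add: f(2) vdiff_on_classes vnorm_on_classes)
  also have "\<dots> < (e powr p) powr (1 / p)"
    using assms(1) less by (intro powr_less_mono2) auto
  also have "\<dots> = e" using assms(1) e by (simp add: powr_powr)
  finally show "\<exists>s\<in>S. vnorm (Lp_space M p) (vdiff (Lp_space M p) x s) < e" using g(2) by blast
qed fact

section \<open>The weighted translation as a linear operator\<close>

lemma borel_measurable_half_line_translate:
  fixes f :: "real \<Rightarrow> 'k::euclidean_space"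
  assumes "f \<in> borel_measurable half_line" "s \<ge> 0"
  shows "(\<lambda>t. f (t + s)) \<in> borel_measurable half_line"
proof -
  have "(\<lambda>t. if t \<in> {0<..} then f t else 0) \<in> borel_measurable lebesgue"
    using assms(1) by (intro borel_measurable_if_I) auto
  moreover have "(\<lambda>t::real. t + s) \<in> lebesgue \<rightarrow>\<^sub>M lebesgue"
    using lebesgue_affine_measurable[of "\<lambda>_. 1::real" s] by (simp add: add.commute)
  ultimately have "(\<lambda>t. if t + s \<in> {0<..} then f (t + s) else 0) \<in> borel_measurable lebesgue"
    by (rule measurable_compose[rotated])
  then have "(\<lambda>t. if t + s \<in> {0<..} then f (t + s) else 0) \<in> borel_measurable half_line"
    by (rule measurable_restrict_space1)
  then show ?thesis
    by (rule measurable_cong[THEN iffD1, rotated]) (use assms(2) in auto)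
qed

lemma borel_measurable_half_lineI:
  fixes f :: "real \<Rightarrow> 'k::real_normed_vector"
  assumes "f \<in> borel_measurable borel"
  shows "f \<in> borel_measurable half_line"
  using assms by (intro measurable_restrict_space1 measurable_completion) simp

lemma borel_measurable_translate_fun:
  fixes f :: "real \<Rightarrow> 'k::{real_normed_field, euclidean_space}"
  assumes "f \<in> borel_measurable half_line" "a > 0"
  shows "translate_fun w a f \<in> borel_measurable half_line"
proof -
  have [measurable]: "(\<lambda>t. f (t + a)) \<in> borel_measurable half_line"
    using assms by (intro borel_measurable_half_line_translate) auto
  have [measurable]: "(\<lambda>t. of_real (w powr t) :: 'k) \<in> borel_measurable half_line"
    by (intro borel_measurable_half_lineI) measurable
  show ?thesis unfolding translate_fun_def by measurable
qed

lemma dom_weighted_translation_iff: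
  fixes f :: "real \<Rightarrow> 'k::{real_normed_field, euclidean_space}"
  assumes f: "f \<in> borel_measurable half_line" and "a > 0"
  shows "ae_class half_line f \<in> dom_of (weighted_translation p w a) \<longleftrightarrow>
    p_integrable half_line p f \<and> p_integrable half_line p (translate_fun w a f)"
proof -
  let ?r = "rep (ae_class half_line f)"
  note r = rep_ae_class[OF f]
  have "AE t in half_line. ?r (t + a) = f (t + a)"
    by (rule AE_half_line_translate) (use r(2) assms(2) in auto)
  then have "AE t in half_line. translate_fun w a ?r t = translate_fun w a f t"
    by eventually_elim (simp add: translate_fun_def)
  from p_integrable_cong_AE[OF borel_measurable_translate_fun[OF r(1) assms(2)]
      borel_measurable_translate_fun[OF f assms(2)] this, of p]
  show ?thesis
    using borel_measurable_translate_fun[OF r(1) assms(2)] Lp_carrier_iff[OF f]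
    by (auto simp: weighted_translation_def p_integrable_def)
qed

lemma linear_operator_weighted_translation:
  assumes "a > 0" "p \<ge> 0"
  shows "linear_operator (Lp_space half_line p)
    (weighted_translation p w a :: (real \<Rightarrow> 'k::{real_normed_field, euclidean_space}) set operator)"
    (is "linear_operator ?X ?T")
proof -
  have E: "\<exists>f. p_integrable half_line p f \<and> p_integrable half_line p (translate_fun w a f)
      \<and> F = ae_class half_line f" if F: "F \<in> dom_of ?T" for F
  proof -
    have "F \<in> vcarrier ?X" using F by (simp add: weighted_translation_def)
    then obtain f where f: "p_integrable half_line p f" "F = ae_class half_line f"
      by (rule Lp_carrierE)
    then show ?thesis
      using F dom_weighted_translation_iff[of f a p w] assms(1) by (auto simp: p_integrable_def)
  qed
  have meas: "f \<in> borel_measurable half_line" if "p_integrable half_line p f" for f :: "real \<Rightarrow> 'k"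
    using that by (simp add: p_integrable_def)
  have add: "translate_fun w a (\<lambda>t. f t + g t) = (\<lambda>t. translate_fun w a f t + translate_fun w a g t)"
    and scale: "translate_fun w a (\<lambda>t. c * f t) = (\<lambda>t. c * translate_fun w a f t)"
    for f g :: "real \<Rightarrow> 'k" and c
    by (auto simp: translate_fun_def algebra_simps)
  show ?thesis
    unfolding linear_operator_def
  proof (intro conjI ballI allI)
    show "dom_of ?T \<subseteq> vcarrier ?X" by (auto simp: weighted_translation_def)
    have "vzero ?X = ae_class half_line (\<lambda>t. 0)" by (simp add: Lp_space_def)
    moreover have "ae_class half_line (\<lambda>t. 0 :: 'k) \<in> dom_of ?T"
      using assms(1) by (subst dom_weighted_translation_iff) (auto simp: p_integrable_def translate_fun_def)
    ultimately show "vzero ?X \<in> dom_of ?T" by simp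
  next
    fix F assume "F \<in> dom_of ?T"
    then obtain f where f: "p_integrable half_line p f" "p_integrable half_line p (translate_fun w a f)"
      "F = ae_class half_line f" using E by blast
    show "app ?T F \<in> vcarrier ?X"
      using f assms(1) by (simp add: meas weighted_translation_on_classes Lp_carrier_iff)
    fix c
    note cf = p_integrable_scale[OF f(1), of c] p_integrable_scale[OF f(2), of c]
    have S: "vscale ?X c F = ae_class half_line (\<lambda>t. c * f t)"
      using f by (simp add: vscale_on_classes meas)
    show "vscale ?X c F \<in> dom_of ?T"
      unfolding S using cf assms(1) by (simp add: dom_weighted_translation_iff meas scale)
    show "app ?T (vscale ?X c F) = vscale ?X c (app ?T F)"
      unfolding S using f cf assms(1)
      by (simp add: weighted_translation_on_classes meas scale vscale_on_classes)
  next
    fix F G assume "F \<in> dom_of ?T" "G \<in> dom_of ?T"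
    then obtain f g where f: "p_integrable half_line p f" "p_integrable half_line p (translate_fun w a f)"
      "F = ae_class half_line f" and g: "p_integrable half_line p g"
      "p_integrable half_line p (translate_fun w a g)" "G = ae_class half_line g"
      using E by metis
    note fg = p_integrable_add[OF f(1) g(1) assms(2)] p_integrable_add[OF f(2) g(2) assms(2)]
    have S: "vadd ?X F G = ae_class half_line (\<lambda>t. f t + g t)"
      using f g by (simp add: Lp_space_on_classes meas)
    show "vadd ?X F G \<in> dom_of ?T"
      unfolding S using fg assms(1) by (simp add: dom_weighted_translation_iff meas add)
    show "app ?T (vadd ?X F G) = vadd ?X (app ?T F) (app ?T G)"
      unfolding S using f g fg assms(1)
      by (simp add: weighted_translation_on_classes meas add Lp_space_on_classes(1))
  qed
qed

section \<open>Reduction to the unweighted translation\<close>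

text \<open>
  A positive solution of \<open>w\<^sup>t v(t + a) = v(t)\<close>: its logarithm to base \<open>w\<close> must decrease by \<open>t\<close> from
  \<open>t\<close> to \<open>t + a\<close>, which makes it quadratic, and the linear term \<open>t/2\<close> adjusts the constant.
\<close>

definition gauss :: "real \<Rightarrow> real \<Rightarrow> real \<Rightarrow> real" where
  "gauss w a t = w powr (t / 2 - t\<^sup>2 / (2 * a))"

definition gauss_mult :: "real \<Rightarrow> real \<Rightarrow> (real \<Rightarrow> 'k::real_normed_field) \<Rightarrow> real \<Rightarrow> 'k" where
  "gauss_mult w a g = (\<lambda>t. of_real (gauss w a t) * g t)"

text \<open>
  The growth admitted here is invariant under translation and is compensated by the Gaussian, so that
  multiplication by \<open>gauss\<close> sends these functions into the domain of every power of the operator.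
\<close>

definition exp_bounded :: "(real \<Rightarrow> 'k::real_normed_field) \<Rightarrow> bool" where
  "exp_bounded g \<longleftrightarrow> g \<in> borel_measurable half_line \<and> (\<exists>K c. \<forall>t>0. norm (g t) \<le> K * exp (c * t))"

lemma gauss_pos: "w > 1 \<Longrightarrow> gauss w a t > 0"
  by (simp add: gauss_def)

lemma gauss_shift:
  assumes "w > 1" "a > 0"
  shows "w powr t * gauss w a (t + a) = gauss w a t"
proof -
  have "(t + a)\<^sup>2 = t\<^sup>2 + t * (2 * a) + (a / 2) * (2 * a)"
    by (simp add: power2_eq_square algebra_simps)
  then have "(t + a)\<^sup>2 / (2 * a) = t\<^sup>2 / (2 * a) + t + a / 2"
    using assms(2) by (simp add: add_divide_distrib)
  then have "t + ((t + a) / 2 - (t + a)\<^sup>2 / (2 * a)) = t / 2 - t\<^sup>2 / (2 * a)"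
    by (simp add: add_divide_distrib)
  then show ?thesis unfolding gauss_def powr_add[symmetric] by (rule arg_cong)
qed

text \<open>
  Completing the square in the exponent gives \<open>K\<close>. The factor \<open>exp (- t)\<close> on the right is what makes the
  bound integrable.
\<close>

lemma gauss_decay:
  assumes "w > 1" "a > 0"
  obtains K where "K > 0" "\<And>t. gauss w a t * exp (c * t) \<le> K * exp (- t)"
proof
  define \<beta> s where "\<beta> = ln w / (2 * a)" and "s = (ln w / 2 + c + 1) / (2 * \<beta>)"
  have \<beta>: "\<beta> > 0" using assms by (simp add: \<beta>_def)
  show "exp (\<beta> * s\<^sup>2) > 0" by simp
  fix t
  have b: "ln w / 2 + c + 1 = 2 * \<beta> * s" using \<beta> by (simp add: s_def)
  have "(t / 2 - t\<^sup>2 / (2 * a)) * ln w + c * t = (ln w / 2 + c + 1) * t - \<beta> * t\<^sup>2 - t"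
    by (simp add: \<beta>_def ring_distribs mult.commute)
  also have "\<dots> = \<beta> * s\<^sup>2 - \<beta> * (t - s)\<^sup>2 - t"
    unfolding b by (simp add: power2_eq_square ring_distribs)
  also have "\<dots> \<le> \<beta> * s\<^sup>2 - t" using \<beta> by simp
  finally have "exp ((t / 2 - t\<^sup>2 / (2 * a)) * ln w + c * t) \<le> exp (\<beta> * s\<^sup>2 - t)" by simp
  then show "gauss w a t * exp (c * t) \<le> exp (\<beta> * s\<^sup>2) * exp (- t)"
    using assms by (simp add: gauss_def powr_def exp_add[symmetric])
qed

lemma p_integrable_exp_minus:
  assumes "p > 0"
  shows "p_integrable half_line p (\<lambda>t. exp (- t) :: real)"
proof -
  have "(\<lambda>t::real. exp (- p * t)) absolutely_integrable_on {0..}"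
    using integrable_on_exp_minus_to_infinity[OF assms, of 0]
    by (rule nonnegative_absolutely_integrable_1) simp
  then have "(\<lambda>t::real. exp (- p * t)) absolutely_integrable_on {0<..}"
    by (rule set_integrable_subset) auto
  then have "integrable half_line (\<lambda>t::real. exp (- p * t))"
    by (simp add: integrable_restrict_space set_integrable_def)
  moreover have "norm (exp (- t) :: real) powr p = exp (- p * t)" for t :: real
    by (simp add: powr_def)
  ultimately show ?thesis
    unfolding p_integrable_def by (simp add: borel_measurable_half_lineI)
qed

lemma exp_boundedI:
  assumes "g \<in> borel_measurable borel" "\<And>t. norm (g t) \<le> B"
  shows "exp_bounded g"
  unfolding exp_bounded_def using assms
  by (intro conjI exI[of _ B] exI[of _ 0]) (auto intro: borel_measurable_half_lineI)

lemma exp_bounded_shift: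
  fixes g :: "real \<Rightarrow> 'k::{real_normed_field, euclidean_space}"
  assumes "exp_bounded g" "s \<ge> 0"
  shows "exp_bounded (\<lambda>t. g (t + s))"
proof -
  obtain K c where K: "\<And>t. t > 0 \<Longrightarrow> norm (g t) \<le> K * exp (c * t)"
    using assms(1) by (auto simp: exp_bounded_def)
  have "norm (g (t + s)) \<le> (K * exp (c * s)) * exp (c * t)" if "t > 0" for t
    using K[of "t + s"] that assms(2) by (simp add: algebra_simps exp_add)
  moreover have "(\<lambda>t. g (t + s)) \<in> borel_measurable half_line"
    using assms by (simp add: exp_bounded_def borel_measurable_half_line_translate)
  ultimately show ?thesis
    unfolding exp_bounded_def by (intro conjI exI[of _ "K * exp (c * s)"] exI[of _ c]) auto
qed

lemma borel_measurable_gauss_mult: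
  fixes g :: "real \<Rightarrow> 'k::{real_normed_field, euclidean_space}"
  assumes [measurable]: "g \<in> borel_measurable half_line"
  shows "gauss_mult w a g \<in> borel_measurable half_line"
proof -
  have [measurable]: "(\<lambda>t. of_real (gauss w a t) :: 'k) \<in> borel_measurable half_line"
    unfolding gauss_def by (intro borel_measurable_half_lineI) measurable
  show ?thesis unfolding gauss_mult_def by measurable
qed

lemma gauss_mult_eq_0_iff: "w > 1 \<Longrightarrow> gauss_mult w a g t = 0 \<longleftrightarrow> g t = 0"
  using gauss_pos[of w a t] by (simp add: gauss_mult_def)

lemma gauss_mult_not_AE_0:
  fixes g :: "real \<Rightarrow> 'k::{real_normed_field, euclidean_space}"
  assumes w: "w > 1" and g: "g \<in> borel_measurable half_line"
    and "b > 0" and nz: "\<And>t. 0 < t \<Longrightarrow> t < b \<Longrightarrow> g t \<noteq> 0"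
  shows "\<not> (AE t in half_line. gauss_mult w a g t = 0)"
proof
  assume "AE t in half_line. gauss_mult w a g t = 0"
  then have "AE t in half_line. g t = 0" by (simp add: gauss_mult_eq_0_iff[OF w])
  then have "AE t in lebesgue. t > 0 \<longrightarrow> g t = 0"
    by (simp add: AE_restrict_space_iff)
  then have "AE t in lebesgue. t \<notin> {0<..<b}"
    by eventually_elim (use nz in auto)
  then have "{0<..<b} \<in> null_sets lebesgue" by (subst (asm) AE_iff_null_sets[symmetric]) auto
  then have "emeasure lebesgue {0<..<b} = 0" by auto
  then show False using \<open>b > 0\<close> by simp
qed

context
  fixes p w a :: real
  assumes p: "1 \<le> p" and w: "w > 1" and a: "a > 0"
begin

lemma p_integrable_gauss_exp: "p_integrable half_line p (\<lambda>t. K * gauss w a t * exp (c * t))"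
proof -
  obtain K' where K': "K' > 0" "\<And>t. gauss w a t * exp (c * t) \<le> K' * exp (- t)"
    using gauss_decay[OF w a, of c] by blast
  have "p_integrable half_line p (\<lambda>t. \<bar>K\<bar> * K' * exp (- t))"
    using p by (intro p_integrable_scale p_integrable_exp_minus) simp
  then show ?thesis
  proof (rule p_integrable_bound[rotated])
    show "AE t in half_line. norm (K * gauss w a t * exp (c * t)) \<le> norm (\<bar>K\<bar> * K' * exp (- t))"
    proof (intro AE_I2)
      fix t
      have "norm (K * gauss w a t * exp (c * t)) = \<bar>K\<bar> * (gauss w a t * exp (c * t))"
        using gauss_pos[OF w, of a t] by (simp add: abs_mult)
      also have "\<dots> \<le> \<bar>K\<bar> * (K' * exp (- t))" by (intro mult_left_mono K') simp
      finally show "norm (K * gauss w a t * exp (c * t)) \<le> norm (\<bar>K\<bar> * K' * exp (- t))"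
        using K'(1) by (simp add: abs_mult)
    qed
    show "(\<lambda>t. K * gauss w a t * exp (c * t)) \<in> borel_measurable half_line"
      unfolding gauss_def by (intro borel_measurable_half_lineI) measurable
  qed (use p in auto)
qed

lemma norm_gauss_mult: "norm (gauss_mult w a g t) = gauss w a t * norm (g t)"
  using gauss_pos[OF w, of a t] by (simp add: gauss_mult_def norm_mult)

lemma p_integrable_gauss_mult:
  fixes g :: "real \<Rightarrow> 'k::{real_normed_field, euclidean_space}"
  assumes "exp_bounded g"
  shows "p_integrable half_line p (gauss_mult w a g)"
proof -
  obtain K c where K: "\<And>t. t > 0 \<Longrightarrow> norm (g t) \<le> K * exp (c * t)"
    using assms by (auto simp: exp_bounded_def)
  show ?thesis
  proof (rule p_integrable_bound[OF _ p_integrable_gauss_exp[of K c]])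
    show "gauss_mult w a g \<in> borel_measurable half_line"
      using assms by (simp add: exp_bounded_def borel_measurable_gauss_mult)
    show "AE t in half_line. norm (gauss_mult w a g t) \<le> norm (K * gauss w a t * exp (c * t))"
    proof (rule AE_I2)
      fix t :: real assume "t \<in> space half_line"
      then have "norm (g t) \<le> \<bar>K * exp (c * t)\<bar>" using K[of t] by auto
      then have "norm (gauss_mult w a g t) \<le> gauss w a t * \<bar>K * exp (c * t)\<bar>"
        using gauss_pos[OF w, of a t] by (simp add: norm_gauss_mult)
      then show "norm (gauss_mult w a g t) \<le> norm (K * gauss w a t * exp (c * t))"
        using gauss_pos[OF w, of a t] by (simp add: abs_mult ac_simps)
    qed
  qed (use p in auto)
qed

lemma translate_fun_gauss_mult:
  "translate_fun w a (gauss_mult w a g) = gauss_mult w a (\<lambda>t. g (t + a))"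
proof
  fix t
  have "translate_fun w a (gauss_mult w a g) t = of_real (w powr t * gauss w a (t + a)) * g (t + a)"
    by (simp add: translate_fun_def gauss_mult_def mult.assoc)
  then show "translate_fun w a (gauss_mult w a g) t = gauss_mult w a (\<lambda>t. g (t + a)) t"
    unfolding gauss_shift[OF w a] by (simp add: gauss_mult_def)
qed

text \<open>
  The weight \<open>w powr t\<close> is absorbed by the Gaussian; the image lies in \<open>L\<^sub>p\<close> because translates of
  exponentially bounded functions are again exponentially bounded.
\<close>

lemma weighted_translation_gauss_mult:
  fixes g :: "real \<Rightarrow> 'k::{real_normed_field, euclidean_space}"
  assumes "exp_bounded g"
  shows "ae_class half_line (gauss_mult w a g) \<in> dom_of (weighted_translation p w a)"
    and "app (weighted_translation p w a) (ae_class half_line (gauss_mult w a g)) =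
      ae_class half_line (gauss_mult w a (\<lambda>t. g (t + a)))"
proof -
  have m: "gauss_mult w a g \<in> borel_measurable half_line"
    using assms by (simp add: exp_bounded_def borel_measurable_gauss_mult)
  show "ae_class half_line (gauss_mult w a g) \<in> dom_of (weighted_translation p w a)"
    using dom_weighted_translation_iff[OF m a] a assms
    by (simp add: translate_fun_gauss_mult p_integrable_gauss_mult exp_bounded_shift)
  show "app (weighted_translation p w a) (ae_class half_line (gauss_mult w a g)) =
      ae_class half_line (gauss_mult w a (\<lambda>t. g (t + a)))"
    by (simp add: weighted_translation_on_classes[OF m a] translate_fun_gauss_mult)
qed

lemma weighted_translation_pow_gauss_mult:
  fixes g :: "real \<Rightarrow> 'k::{real_normed_field, euclidean_space}"
  assumes "exp_bounded g"
  shows "(app (weighted_translation p w a) ^^ n) (ae_class half_line (gauss_mult w a g)) =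
      ae_class half_line (gauss_mult w a (\<lambda>t. g (t + real n * a)))"
proof (induction n)
  case (Suc n)
  have "exp_bounded (\<lambda>t. g (t + real n * a))" using assms a by (intro exp_bounded_shift) auto
  then show ?case
    using Suc by (simp add: weighted_translation_gauss_mult algebra_simps)
qed simp

lemma gauss_mult_in_pow_dom:
  fixes g :: "real \<Rightarrow> 'k::{real_normed_field, euclidean_space}"
  assumes "exp_bounded g"
  shows "ae_class half_line (gauss_mult w a g) \<in>
    pow_dom (Lp_space half_line p) (weighted_translation p w a) n"
proof (induction n)
  case 0
  show ?case
    using p_integrable_gauss_mult[OF assms] by (simp add: Lp_carrier_iff p_integrable_def)
next
  case (Suc n)
  have "exp_bounded (\<lambda>t. g (t + real n * a))" using assms a by (intro exp_bounded_shift) auto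
  then show ?case
    using Suc by (simp add: weighted_translation_pow_gauss_mult[OF assms] weighted_translation_gauss_mult)
qed

text \<open>
  The form in which dominated convergence is applied: the bound concerns the functions before
  multiplication by the Gaussian, and the Gaussian makes it integrable.
\<close>

lemma gauss_mult_dominated_convergence:
  fixes f :: "nat \<Rightarrow> real \<Rightarrow> 'k::{real_normed_field, euclidean_space}"
  assumes fm: "\<And>n. f n \<in> borel_measurable half_line" and gm: "g \<in> borel_measurable half_line"
    and fb: "\<And>n t. t > 0 \<Longrightarrow> norm (f n t) \<le> K * exp (c * t)"
    and gb: "\<And>t. t > 0 \<Longrightarrow> norm (g t) \<le> K * exp (c * t)"
    and lim: "AE t in half_line. (\<lambda>n. f n t) \<longlonglongrightarrow> g t"
  shows "(\<lambda>n. LINT t|half_line. norm (gauss_mult w a (f n) t - gauss_mult w a g t) powr p)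
    \<longlonglongrightarrow> 0"
proof (rule Lp_dominated_convergence[OF _ _ _ p_integrable_gauss_exp[of "2 * K" c]])
  show "AE t in half_line. norm (gauss_mult w a (f n) t - gauss_mult w a g t)
      \<le> norm (2 * K * gauss w a t * exp (c * t))" for n
  proof (rule AE_I2)
    fix t :: real assume "t \<in> space half_line"
    then have "t > 0" by simp
    have "norm (gauss_mult w a (f n) t - gauss_mult w a g t)
        \<le> gauss w a t * norm (f n t) + gauss w a t * norm (g t)"
      by (metis norm_gauss_mult norm_triangle_ineq4)
    also have "\<dots> \<le> gauss w a t * (K * exp (c * t)) + gauss w a t * (K * exp (c * t))"
      using gauss_pos[OF w, of a t] fb[OF \<open>t > 0\<close>, of n] gb[OF \<open>t > 0\<close>]
      by (intro add_mono mult_left_mono) auto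
    also have "\<dots> = 2 * K * gauss w a t * exp (c * t)" by simp
    also have "\<dots> \<le> norm \<dots>" by simp
    finally show "norm (gauss_mult w a (f n) t - gauss_mult w a g t)
        \<le> norm (2 * K * gauss w a t * exp (c * t))" .
  qed
  show "AE t in half_line. (\<lambda>n. gauss_mult w a (f n) t) \<longlonglongrightarrow> gauss_mult w a g t"
    using lim by eventually_elim (auto simp: gauss_mult_def intro!: tendsto_intros)
qed (use p fm gm in \<open>auto intro: borel_measurable_gauss_mult\<close>)

end

section \<open>Density of a countable family\<close>

text \<open>
  The pair \<open>(j, is)\<close> describes the step function with steps of length \<open>1/(j + 1)\<close> and values \<open>d i\<close> for
  the successive entries \<open>i\<close> of \<open>is\<close>. Such codes form a countable type, whatever the field of scalars.
\<close>

definition step_fun :: "(nat \<Rightarrow> 'k::zero) \<Rightarrow> nat \<times> nat list \<Rightarrow> real \<Rightarrow> 'k" where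
  "step_fun d c t =
     (let i = nat \<lfloor>t * real (Suc (fst c))\<rfloor> in if i < length (snd c) then d (snd c ! i) else 0)"

lemma borel_measurable_step_fun:
  "step_fun d c \<in> borel_measurable (borel :: real measure)"
  for d :: "nat \<Rightarrow> 'k::real_normed_vector"
proof -
  have "(\<lambda>t::real. nat \<lfloor>t * real (Suc (fst c))\<rfloor>) \<in> borel \<rightarrow>\<^sub>M count_space UNIV"
    by measurable
  moreover have "(\<lambda>i. if i < length (snd c) then d (snd c ! i) else 0)
      \<in> borel_measurable (count_space UNIV)"
    by simp
  ultimately show ?thesis
    unfolding step_fun_def Let_def by (rule measurable_compose)
qed

lemma step_fun_bounded:
  fixes d :: "nat \<Rightarrow> 'k::real_normed_vector"
  obtains B where "B \<ge> 0" "\<And>t. norm (step_fun d c t) \<le> B"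
proof -
  have "range (step_fun d c) \<subseteq> insert 0 (d ` set (snd c))"
    by (auto simp: step_fun_def Let_def)
  then have "bounded (range (step_fun d c))"
    by (meson List.finite_set bounded_subset finite.insertI finite_imageI finite_imp_bounded)
  then show ?thesis using that by (auto simp: bounded_pos intro: less_imp_le)
qed

lemma exp_bounded_step_fun:
  fixes d :: "nat \<Rightarrow> 'k::real_normed_field"
  shows "exp_bounded (step_fun d c)"
proof -
  obtain B where "B \<ge> 0" "\<And>t. norm (step_fun d c t) \<le> B" using step_fun_bounded[of d c] by blast
  then show ?thesis by (intro exp_boundedI borel_measurable_step_fun)
qed

lemma ex_dense_sequence:
  obtains d :: "nat \<Rightarrow> 'k::{real_normed_vector, second_countable_topology}"
  where "\<And>y e. e > 0 \<Longrightarrow> \<exists>i. norm (d i - y) < e"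
proof -
  obtain D :: "'k set" where D: "countable D"
    "\<And>X. open X \<Longrightarrow> X \<noteq> {} \<Longrightarrow> \<exists>x\<in>D. x \<in> X"
    using countable_dense_setE by blast
  have ball: "\<exists>x\<in>D. norm (x - y) < e" if "e > 0" for y e
    using D(2)[of "ball y e"] that by (auto simp: dist_norm norm_minus_commute)
  then have "D \<noteq> {}" using zero_less_one by blast
  show ?thesis
  proof
    fix y :: 'k and e :: real assume "e > 0"
    then obtain x where "x \<in> D" "norm (x - y) < e" using ball by blast
    then show "\<exists>i. norm (from_nat_into D i - y) < e"
      using from_nat_into_surj[OF D(1)] by metis
  qed
qed

text \<open>
  Uniform continuity on a compact interval determines the step length. Where \<open>q\<close> is large, its value is
  replaced by \<open>0\<close> before it is approximated by some \<open>d i\<close>; this yields a bound on the step function that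
  does not depend on \<open>q\<close>, as dominated convergence will require.
\<close>

lemma step_fun_near_continuous:
  fixes d :: "nat \<Rightarrow> 'k::real_normed_vector" and L :: nat
  assumes d: "\<And>y e. e > 0 \<Longrightarrow> \<exists>i. norm (d i - y) < e"
    and q: "continuous_on UNIV q" and e: "e > 0" "e \<le> 1 / 2" and M: "M \<ge> 0"
  shows "\<exists>c. (\<forall>t. norm (step_fun d c t) \<le> M + 2) \<and>
    (\<forall>t. 0 < t \<and> t < real L \<and> norm (q t) \<le> M + 1 / 2 \<longrightarrow> norm (step_fun d c t - q t) < 2 * e)"
proof -
  have "uniformly_continuous_on {0..real L} q"
    using q by (intro compact_uniformly_continuous) (auto intro: continuous_on_subset)
  then obtain \<delta> where \<delta>: "\<delta> > 0"
    "\<And>s t. s \<in> {0..real L} \<Longrightarrow> t \<in> {0..real L} \<Longrightarrow> dist t s < \<delta> \<Longrightarrow> dist (q t) (q s) < e"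
    unfolding uniformly_continuous_on_def using e(1) by metis
  obtain j where j: "1 / real (Suc j) < \<delta>"
    using \<delta>(1) reals_Archimedean by (auto simp: inverse_eq_divide)
  define J where "J = real (Suc j)"
  have J: "J > 0" "1 / J < \<delta>" using j by (auto simp: J_def)
  \<comment> \<open>The threshold exceeds \<open>M + 1 / 2\<close> by enough to leave grid values unchanged wherever \<open>q\<close> is at most
    \<open>M + 1 / 2\<close> at a point of the corresponding step.\<close>
  define y where "y i = (if norm (q (real i / J)) \<le> M + 1 then q (real i / J) else 0)" for i
  have y: "norm (y i) \<le> M + 1" for i using M by (simp add: y_def)
  have "\<forall>i. \<exists>j. norm (d j - y i) < e" using d[OF e(1)] by blast
  then obtain k where k: "\<And>i. norm (d (k i) - y i) < e" by metis
  define c where "c = (j, map k [0..<L * Suc j])"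
  have c: "step_fun d c t = (if nat \<lfloor>t * J\<rfloor> < L * Suc j then d (k (nat \<lfloor>t * J\<rfloor>)) else 0)" for t
    by (simp add: step_fun_def c_def J_def Let_def del: of_nat_Suc mult_Suc_right)
  show ?thesis
  proof (intro exI[of _ c] conjI allI impI)
    fix t
    have "norm (d (k i)) \<le> M + 2" for i
      using k[of i] y[of i] e(2) norm_triangle_sub[of "d (k i)" "y i"] by linarith
    then show "norm (step_fun d c t) \<le> M + 2" using M by (simp add: c)
  next
    fix t assume "0 < t \<and> t < real L \<and> norm (q t) \<le> M + 1 / 2"
    then have t: "0 < t" "t < real L" "norm (q t) \<le> M + 1 / 2" by auto
    define i where "i = nat \<lfloor>t * J\<rfloor>"
    have i: "real i \<le> t * J" "t * J < real i + 1" using t(1) J(1) by (auto simp: i_def)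
    have "real i < real L * J" using i(1) t(2) J(1) by (meson le_less_trans mult_strict_right_mono)
    then have "real i < real (L * Suc j)" unfolding J_def of_nat_mult .
    then have iL: "i < L * Suc j" by (simp only: of_nat_less_iff)
    have s: "real i / J \<le> t" "t < real i / J + 1 / J"
      using i J(1) by (simp_all add: field_simps)
    have "norm (q (real i / J) - q t) < e"
      unfolding dist_norm[symmetric] using s t J by (intro \<delta>(2)) (auto simp: dist_real_def)
    moreover have "y i = q (real i / J)"
      using calculation t(3) e(2) norm_triangle_sub[of "q (real i / J)" "q t"] by (simp add: y_def)
    moreover have "norm (d (k i) - q t) \<le> norm (d (k i) - q (real i / J)) + norm (q (real i / J) - q t)"
      using norm_triangle_ineq[of "d (k i) - q (real i / J)" "q (real i / J) - q t"] by simp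
    ultimately have "norm (d (k i) - q t) < 2 * e" using k[of i] by simp
    then show "norm (step_fun d c t - q t) < 2 * e"
      using iL by (simp add: c i_def del: mult_Suc_right)
  qed
qed

text \<open>
  A Lebesgue measurable function is almost everywhere the limit of continuous functions; these need not be
  bounded, but at almost every point their norms eventually fall below \<open>M + 1/2\<close>.
\<close>

lemma bounded_AE_limit_of_step_fun:
  fixes d :: "nat \<Rightarrow> 'k::euclidean_space"
  assumes d: "\<And>y e. e > 0 \<Longrightarrow> \<exists>i. norm (d i - y) < e"
    and g: "g \<in> borel_measurable half_line" and M: "\<And>t. norm (g t) \<le> M"
  obtains c where "\<And>n t. norm (step_fun d (c n) t) \<le> M + 2"
    "AE t in half_line. (\<lambda>n. step_fun d (c n) t) \<longlonglongrightarrow> g t"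
proof -
  have M0: "M \<ge> 0" using M[of 0] norm_ge_zero order_trans by blast
  have "g measurable_on {0<..}" using g by (simp add: measurable_on_iff_borel_measurable)
  then obtain N q where N: "negligible N" and q: "\<And>n. continuous_on UNIV (q n)"
    and lim: "\<And>t. t \<notin> N \<Longrightarrow> (\<lambda>n. q n t) \<longlonglongrightarrow> (if t \<in> {0<..} then g t else 0)"
    unfolding measurable_on_def by blast
  \<comment> \<open>The errors \<open>1 / (n + 2)\<close> tend to zero and are at most \<open>1 / 2\<close> from the start.\<close>
  have "\<exists>c. (\<forall>t. norm (step_fun d c t) \<le> M + 2) \<and>
      (\<forall>t. 0 < t \<and> t < real n \<and> norm (q n t) \<le> M + 1 / 2 \<longrightarrow>
        norm (step_fun d c t - q n t) < 2 * (1 / (real n + 2)))" for n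
    by (rule step_fun_near_continuous[OF d q _ _ M0]) (auto simp: field_simps)
  then obtain c where c: "\<And>n t. norm (step_fun d (c n) t) \<le> M + 2"
    "\<And>n t. 0 < t \<Longrightarrow> t < real n \<Longrightarrow> norm (q n t) \<le> M + 1 / 2 \<Longrightarrow>
        norm (step_fun d (c n) t - q n t) < 2 * (1 / (real n + 2))"
    by metis
  have conv: "(\<lambda>n. step_fun d (c n) t) \<longlonglongrightarrow> g t" if t: "t > 0" "t \<notin> N" for t
  proof -
    have L: "(\<lambda>n. q n t) \<longlonglongrightarrow> g t" using lim[OF t(2)] t(1) by simp
    have "norm (g t) < M + 1 / 2" using M[of t] by simp
    then have "eventually (\<lambda>n. norm (q n t) < M + 1 / 2) sequentially"
      by (rule order_tendstoD(2)[OF tendsto_norm[OF L]])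
    moreover have "eventually (\<lambda>n. t < real n) sequentially"
      using filterlim_real_sequentially by (simp add: filterlim_at_top_dense)
    ultimately have "eventually (\<lambda>n. norm (step_fun d (c n) t - q n t) \<le> 2 * (1 / (real n + 2)))
        sequentially"
      by eventually_elim (use c(2) t(1) in \<open>auto intro: less_imp_le\<close>)
    moreover have "(\<lambda>n. 2 * (1 / (real n + 2))) \<longlonglongrightarrow> 0"
      using tendsto_mult_right_zero[OF LIMSEQ_ignore_initial_segment[OF LIMSEQ_inverse_real_of_nat, of 1], of 2]
      by (simp add: inverse_eq_divide add.commute)
    ultimately have "(\<lambda>n. step_fun d (c n) t - q n t) \<longlonglongrightarrow> 0"
      by (rule Lim_null_comparison)
    from tendsto_add[OF this L] show ?thesis by simp
  qed
  have "AE t in lebesgue. t \<notin> N"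
    using N by (simp add: negligible_iff_null_sets AE_not_in)
  then have "AE t in half_line. (\<lambda>n. step_fun d (c n) t) \<longlonglongrightarrow> g t"
    by (simp add: AE_restrict_space_iff) (auto intro: conv elim: eventually_mono)
  with c(1) show ?thesis by (rule that)
qed

text \<open>
  Two approximations: first \<open>f\<close> is cut off where the quotient of \<open>f\<close> by the Gaussian exceeds \<open>m\<close>; the
  bounded quotient that remains is then a limit of uniformly bounded step functions.
\<close>

lemma gauss_mult_step_fun_dense:
  fixes d :: "nat \<Rightarrow> 'k::{real_normed_field, euclidean_space}"
  assumes p: "1 \<le> p" and w: "w > 1" and a: "a > 0"
    and d: "\<And>y e. e > 0 \<Longrightarrow> \<exists>i. norm (d i - y) < e"
    and f: "p_integrable half_line p f" and e: "e > 0"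
  obtains c where "(LINT t|half_line. norm (f t - gauss_mult w a (step_fun d c) t) powr p) < e"
proof -
  have [measurable]: "f \<in> borel_measurable half_line" using f by (simp add: p_integrable_def)
  have [measurable]: "(\<lambda>t. of_real (gauss w a t) :: 'k) \<in> borel_measurable half_line"
    unfolding gauss_def by (intro borel_measurable_half_lineI) measurable
  define g where "g m t = (if norm (f t / of_real (gauss w a t)) \<le> real m
      then f t / of_real (gauss w a t) else 0)" for m :: nat and t
  have gm: "g m \<in> borel_measurable half_line" for m
    unfolding g_def by measurable
  have gt: "exp_bounded (g m)" for m
    unfolding exp_bounded_def using gm
    by (intro conjI exI[of _ "real m"] exI[of _ 0]) (auto simp: g_def)
  have gf: "gauss_mult w a (g m) t =
      (if norm (f t / of_real (gauss w a t)) \<le> real m then f t else 0)" for m t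
    using gauss_pos[OF w, of a t] by (simp add: gauss_mult_def g_def)
  have "(\<lambda>m. LINT t|half_line. norm (gauss_mult w a (g m) t - f t) powr p) \<longlonglongrightarrow> 0"
  proof (rule Lp_dominated_convergence[OF _ _ _ f])
    show "AE t in half_line. (\<lambda>m. gauss_mult w a (g m) t) \<longlonglongrightarrow> f t"
    proof (rule AE_I2)
      fix t
      have "eventually (\<lambda>m. norm (f t / of_real (gauss w a t)) < real m) sequentially"
        using filterlim_real_sequentially by (simp add: filterlim_at_top_dense)
      then have "eventually (\<lambda>m. gauss_mult w a (g m) t = f t) sequentially"
        by eventually_elim (simp add: gf)
      then show "(\<lambda>m. gauss_mult w a (g m) t) \<longlonglongrightarrow> f t" by (rule tendsto_eventually)
    qed
  qed (use p gm in \<open>auto simp: gf intro: borel_measurable_gauss_mult\<close>)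
  from order_tendstoD(2)[OF this, of "e / (2 * 2 powr p)"]
  obtain m where "(LINT t|half_line. norm (gauss_mult w a (g m) t - f t) powr p) < e / (2 * 2 powr p)"
    using e by (auto simp: eventually_sequentially)
  then have m: "(LINT t|half_line. norm (f t - gauss_mult w a (g m) t) powr p) < e / (2 * 2 powr p)"
    by (simp add: norm_minus_commute)
  obtain c where c: "\<And>n t. norm (step_fun d (c n) t) \<le> real m + 2"
    "AE t in half_line. (\<lambda>n. step_fun d (c n) t) \<longlonglongrightarrow> g m t"
    by (rule bounded_AE_limit_of_step_fun[OF d gm, where M = "real m"]) (auto simp: g_def)
  have st: "exp_bounded (step_fun d (c n))" for n
    by (rule exp_bounded_step_fun)
  have "(\<lambda>n. LINT t|half_line. norm (gauss_mult w a (step_fun d (c n)) t - gauss_mult w a (g m) t) powr p)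
      \<longlonglongrightarrow> 0"
    by (rule gauss_mult_dominated_convergence[OF p w a, where K = "real m + 2" and c = 0])
      (use c gm st in \<open>auto simp: g_def exp_bounded_def\<close>)
  with p e f show ?thesis
    by (intro Lp_approx_trans[OF _ e f p_integrable_gauss_mult[OF p w a gt]
      p_integrable_gauss_mult[OF p w a st] m _ that]) auto
qed

section \<open>Eigenvectors and unboundedness\<close>

context
  fixes p w a :: real
  assumes p: "1 \<le> p" and w: "w > 1" and a: "a > 0"
begin

text \<open>
  After the reduction, an eigenvector is a function that translation by \<open>a\<close> multiplies by \<open>\<mu>\<close>.
\<close>

lemma weighted_translation_eigenvector:
  fixes g :: "real \<Rightarrow> 'k::{real_normed_field, euclidean_space}"
  assumes g: "exp_bounded g" and b: "b > 0" and nz: "\<And>t. 0 < t \<Longrightarrow> t < b \<Longrightarrow> g t \<noteq> 0"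
    and ev: "\<And>t. t > 0 \<Longrightarrow> g (t + a) = \<mu> * g t"
  obtains f where "p_integrable half_line p f" "\<not> (AE t in half_line. f t = 0)"
    "ae_class half_line f \<in> dom_of (weighted_translation p w a)"
    "app (weighted_translation p w a) (ae_class half_line f) =
      vscale (Lp_space half_line p) \<mu> (ae_class half_line f)"
proof
  have m: "g \<in> borel_measurable half_line" using g by (simp add: exp_bounded_def)
  show "p_integrable half_line p (gauss_mult w a g)" by (rule p_integrable_gauss_mult[OF p w a g])
  show "\<not> (AE t in half_line. gauss_mult w a g t = 0)" by (rule gauss_mult_not_AE_0[OF w m b nz])
  note T = weighted_translation_gauss_mult[OF p w a g]
  show "ae_class half_line (gauss_mult w a g) \<in> dom_of (weighted_translation p w a)" by (rule T)
  have "AE t in half_line. gauss_mult w a (\<lambda>t. g (t + a)) t = \<mu> * gauss_mult w a g t"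
    by (rule AE_I2) (simp add: gauss_mult_def ev)
  then show "app (weighted_translation p w a) (ae_class half_line (gauss_mult w a g)) =
      vscale (Lp_space half_line p) \<mu> (ae_class half_line (gauss_mult w a g))"
    unfolding T(2) vscale_on_classes[OF borel_measurable_gauss_mult[OF m]] by (rule ae_class_cong)
qed

text \<open>
  The functions \<open>exp (c t)\<close> yield eigenvalues \<open>exp (c a)\<close> that exceed every bound on the operator.
\<close>

lemma weighted_translation_unbounded:
  "unbounded_linear_operator (Lp_space half_line p)
    (weighted_translation p w a :: (real \<Rightarrow> 'k::{real_normed_field, euclidean_space}) set operator)"
    (is "unbounded_linear_operator ?X ?T")
  unfolding unbounded_linear_operator_def
proof
  show "linear_operator ?X ?T" using p a by (intro linear_operator_weighted_translation) auto
  show "\<not> bounded_operator ?X ?T"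
  proof
    assume "bounded_operator ?X ?T"
    then obtain C where C: "\<And>F. F \<in> dom_of ?T \<Longrightarrow> vnorm ?X (app ?T F) \<le> C * vnorm ?X F"
      unfolding bounded_operator_def by blast
    define c where "c = \<bar>C\<bar> / a"
    let ?g = "\<lambda>t. of_real (exp (c * t)) :: 'k"
    have "?g \<in> borel_measurable half_line" by (intro borel_measurable_half_lineI) measurable
    then have g: "exp_bounded ?g"
      unfolding exp_bounded_def by (intro conjI exI[of _ 1] exI[of _ c]) auto
    have "?g (t + a) = of_real (exp (c * a)) * ?g t" for t
      by (simp add: ring_distribs exp_add)
    then obtain f :: "real \<Rightarrow> 'k" where f: "p_integrable half_line p f" "\<not> (AE t in half_line. f t = 0)"
      "ae_class half_line f \<in> dom_of ?T"
      "app ?T (ae_class half_line f) = vscale ?X (of_real (exp (c * a))) (ae_class half_line f)"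
      by (rule weighted_translation_eigenvector[OF g zero_less_one, rotated]) auto
    have "f \<in> borel_measurable half_line" using f(1) by (simp add: p_integrable_def)
    then have "exp (c * a) * vnorm ?X (ae_class half_line f) \<le> C * vnorm ?X (ae_class half_line f)"
      using C[OF f(3)] p unfolding f(4) by (simp add: vnorm_vscale)
    moreover have "vnorm ?X (ae_class half_line f) \<noteq> 0"
      using f(1,2) by (simp add: vnorm_eq_0_iff_AE)
    moreover have "vnorm ?X (ae_class half_line f) \<ge> 0" by (simp add: Lp_space_def)
    ultimately have "exp (c * a) \<le> C" by simp
    moreover have "exp (c * a) \<ge> 1 + \<bar>C\<bar>" using exp_ge_add_one_self[of "c * a"] a by (simp add: c_def)
    ultimately show False by simp
  qed
qed

text \<open>
  The complex logarithm provides an exponential for each \<open>\<mu> \<noteq> 0\<close>. A function that vanishes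
  beyond \<open>a\<close> is translated to zero on the half line, which settles \<open>\<mu> = 0\<close>.
\<close>

lemma point_spectrum_weighted_translation:
  "point_spectrum (Lp_complex p) (weighted_translation p w a) = UNIV"
proof (rule UNIV_eq_I[symmetric])
  fix \<mu> :: complex
  let ?X = "Lp_complex p" and ?T = "weighted_translation p w a :: (real \<Rightarrow> complex) set operator"
  obtain f :: "real \<Rightarrow> complex" where f: "p_integrable half_line p f"
    "\<not> (AE t in half_line. f t = 0)" "ae_class half_line f \<in> dom_of ?T"
    "app ?T (ae_class half_line f) = vscale ?X \<mu> (ae_class half_line f)"
  proof (cases "\<mu> = 0")
    case True
    let ?g = "indicator {..a} :: real \<Rightarrow> complex"
    have g: "exp_bounded ?g" by (rule exp_boundedI[of _ 1]) (auto simp: indicator_def)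
    show ?thesis
      by (rule weighted_translation_eigenvector[OF g a, of \<mu>]) (use True that in \<open>auto simp: indicator_def\<close>)
  next
    case False
    define \<alpha> where "\<alpha> = Ln \<mu> / of_real a"
    let ?g = "\<lambda>t. exp (\<alpha> * of_real t)"
    have "?g \<in> borel_measurable half_line"
      by (intro borel_measurable_half_lineI borel_measurable_continuous_onI continuous_intros)
    then have g: "exp_bounded ?g"
      unfolding exp_bounded_def by (intro conjI exI[of _ 1] exI[of _ "Re \<alpha>"]) auto
    have "?g (t + a) = \<mu> * ?g t" for t
      using a False by (simp add: \<alpha>_def ring_distribs exp_add)
    then show ?thesis
      by (rule weighted_translation_eigenvector[OF g a, rotated, of \<mu>]) (use that in auto)
  qed
  have m: "f \<in> borel_measurable half_line" using f(1) by (simp add: p_integrable_def)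
  have T0: "ae_class half_line (\<lambda>t. 0) \<in> dom_of ?T"
    "app ?T (ae_class half_line (\<lambda>t. 0)) = ae_class half_line (\<lambda>t. 0)"
    using a by (auto simp: dom_weighted_translation_iff weighted_translation_on_classes
        translate_fun_def p_integrable_def)
  have "app (minus_scalar ?X ?T \<mu>) (ae_class half_line f) = ae_class half_line (\<lambda>t. 0)"
    using m by (simp add: minus_scalar_def f(4) vscale_on_classes vdiff_on_classes borel_measurable_times)
  moreover have "app (minus_scalar ?X ?T \<mu>) (ae_class half_line (\<lambda>t. 0)) = ae_class half_line (\<lambda>t. 0)"
    by (simp add: minus_scalar_def T0 vscale_on_classes vdiff_on_classes)
  moreover have "ae_class half_line f \<noteq> ae_class half_line (\<lambda>t. 0)"
    using f(2) by (simp add: ae_class_eq_iff[OF m])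
  ultimately have "\<not> inj_on (app (minus_scalar ?X ?T \<mu>)) (dom_of ?T)"
    using f(3) T0(1) by (metis inj_onD)
  then show "\<mu> \<in> point_spectrum ?X ?T" by (simp add: point_spectrum_def)
qed

section \<open>Periodic points\<close>

text \<open>
  Each step function \<open>s\<close> is the limit of the periodic functions that continue the restriction of \<open>s\<close> to
  \<open>(0, (n + 1) a)\<close>.
\<close>

lemma periodic_points_dense:
  "dense_in (Lp_space half_line p) (periodic_points (Lp_space half_line p)
    (weighted_translation p w a :: (real \<Rightarrow> 'k::{real_normed_field, euclidean_space}) set operator))"
    (is "dense_in ?X (periodic_points ?X ?T)")
proof (rule dense_in_LpI)
  have "pow_dom ?X ?T n \<subseteq> vcarrier ?X" for n by (induction n) auto
  then show "periodic_points ?X ?T \<subseteq> vcarrier ?X" by (auto simp: periodic_points_def)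
  show "\<exists>g\<in>borel_measurable half_line. ae_class half_line g \<in> periodic_points ?X ?T
        \<and> (LINT t|half_line. norm (f t - g t) powr p) < e"
    if f: "p_integrable half_line p f" and e: "e > 0" for f :: "real \<Rightarrow> 'k" and e :: real
  proof -
    obtain d :: "nat \<Rightarrow> 'k" where d: "\<And>y e. e > 0 \<Longrightarrow> \<exists>i. norm (d i - y) < e"
      using ex_dense_sequence by blast
    have "e / (2 * 2 powr p) > 0" using e by simp
    from gauss_mult_step_fun_dense[OF p w a d f this]
    obtain c where c: "(LINT t|half_line. norm (f t - gauss_mult w a (step_fun d c) t) powr p)
        < e / (2 * 2 powr p)" by blast
    obtain B where B: "B \<ge> 0" "\<And>t. norm (step_fun d c t) \<le> B" using step_fun_bounded[of d c] by blast
    define L where "L n = real (Suc n) * a" for n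
    have L: "L n > 0" for n using a by (simp add: L_def)
    define g where "g n t = step_fun d c (L n * frac (t / L n))" for n t
    have "(\<lambda>t. L n * frac (t / L n)) \<in> borel_measurable borel" for n
      unfolding frac_def by measurable
    then have gm: "g n \<in> borel_measurable borel" for n
      unfolding g_def by (rule measurable_compose) (rule borel_measurable_step_fun)
    have gt: "exp_bounded (g n)" for n by (rule exp_boundedI[of _ B]) (use gm B in \<open>auto simp: g_def\<close>)
    have st: "exp_bounded (step_fun d c)" by (rule exp_bounded_step_fun)
    have per: "g n (t + real (Suc n) * a) = g n t" for n t
    proof -
      have "(t + real (Suc n) * a) / L n = t / L n + 1"
        unfolding L_def[symmetric] using L[of n] by (simp add: field_simps)
      then show ?thesis by (simp add: g_def frac_def)
    qed
    have "(\<lambda>n. LINT t|half_line. norm (gauss_mult w a (g n) t - gauss_mult w a (step_fun d c) t) powr p)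
        \<longlonglongrightarrow> 0"
    proof (rule gauss_mult_dominated_convergence[OF p w a, where K = B and c = 0])
      show "AE t in half_line. (\<lambda>n. g n t) \<longlonglongrightarrow> step_fun d c t"
      proof (rule AE_I2)
        fix t :: real assume "t \<in> space half_line"
        then have t: "t > 0" by simp
        have "eventually (\<lambda>n. t / a < real n) sequentially"
          using filterlim_real_sequentially by (simp add: filterlim_at_top_dense)
        then have "eventually (\<lambda>n. g n t = step_fun d c t) sequentially"
        proof eventually_elim
          fix n assume "t / a < real n"
          then have "t < L n" using a by (simp add: L_def field_simps)
          then have "frac (t / L n) = t / L n" using t L[of n] by (simp add: frac_eq)
          then show "g n t = step_fun d c t" using L[of n] by (simp add: g_def)
        qed
        then show "(\<lambda>n. g n t) \<longlonglongrightarrow> step_fun d c t" by (rule tendsto_eventually)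
      qed
    qed (use gt st B in \<open>auto simp: g_def exp_bounded_def\<close>)
    with p obtain n where n: "(LINT t|half_line. norm (f t - gauss_mult w a (g n) t) powr p) < e"
      by (elim Lp_approx_trans[OF _ e f p_integrable_gauss_mult[OF p w a st]
        p_integrable_gauss_mult[OF p w a gt] c, rotated]) auto
    have "ae_class half_line (gauss_mult w a (g n)) \<in> periodic_points ?X ?T"
      unfolding periodic_points_def
      using gauss_mult_in_pow_dom[OF p w a gt, of n "Suc n"]
        weighted_translation_pow_gauss_mult[OF p w a gt, of "Suc n" n, unfolded per]
      by (intro CollectI exI[of _ "Suc n"] conjI) auto
    then show ?thesis
      using n gt[of n] by (auto simp: exp_bounded_def intro!: borel_measurable_gauss_mult
          bexI[of _ "gauss_mult w a (g n)"])
  qed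
qed (use p in auto)

end

section \<open>Hypercyclicity\<close>

text \<open>
  The values of \<open>G\<close> on \<open>[2\<^sup>k a, 2\<^sup>k\<^sup>+\<^sup>1 a)\<close> copy \<open>h k\<close>, the index being the integer part of
  \<open>log 2 (s / a)\<close>. As \<open>h k\<close> is bounded by \<open>k\<close> and \<open>k \<le> 2\<^sup>k\<close>, doubling block lengths keep \<open>G\<close> below
  the linear function \<open>s / a\<close>.
\<close>

lemma ex_function_with_prescribed_translates:
  fixes h :: "nat \<Rightarrow> real \<Rightarrow> 'k::real_normed_vector"
  assumes a: "a > 0" and h: "\<And>k. h k \<in> borel_measurable borel" "\<And>k t. norm (h k t) \<le> real k"
  obtains G where "G \<in> borel_measurable borel" "\<And>s. s > 0 \<Longrightarrow> norm (G s) \<le> s / a"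
    "\<And>k t. 0 < t \<Longrightarrow> t < 2 ^ k * a \<Longrightarrow> G (t + 2 ^ k * a) = h k t"
proof
  define k where "k s = nat \<lfloor>log 2 (s / a)\<rfloor>" for s
  define G where "G s = h (k s) (s - 2 ^ k s * a)" for s
  have "k \<in> borel \<rightarrow>\<^sub>M count_space UNIV" unfolding k_def by measurable
  then show "G \<in> borel_measurable borel"
    unfolding G_def
  proof (rule measurable_compose_countable[rotated])
    fix i :: nat
    have "(\<lambda>s. s - 2 ^ i * a) \<in> borel_measurable borel" by measurable
    then show "(\<lambda>s. h i (s - 2 ^ i * a)) \<in> borel_measurable borel"
      by (rule measurable_compose) (rule h)
  qed
  show "norm (G s) \<le> s / a" if s: "s > 0" for s
  proof -
    have "real (k s) \<le> s / a"
    proof (cases "log 2 (s / a) \<ge> 0")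
      case True
      then have "real (k s) \<le> log 2 (s / a)" by (simp add: k_def)
      then have "2 powr real (k s) \<le> s / a" using s a by (simp add: le_log_iff)
      then show ?thesis using of_nat_less_two_power[of "k s", where 'a = real]
        unfolding powr_realpow[OF zero_less_numeral] by (rule order_trans[OF less_imp_le, rotated])
    next
      case False
      then have "\<lfloor>log 2 (s / a)\<rfloor> \<le> 0" by linarith
      then have "k s = 0" by (simp only: k_def nat_0_iff)
      then show ?thesis using s a by simp
    qed
    then show ?thesis using h(2)[of "k s" "s - 2 ^ k s * a"] by (simp add: G_def)
  qed
  show "G (t + 2 ^ i * a) = h i t" if t: "0 < t" "t < 2 ^ i * a" for i t
  proof -
    define u where "u = (t + 2 ^ i * a) / a"
    have u: "2 ^ i \<le> u" "u < 2 ^ Suc i" using t a by (auto simp: u_def field_simps)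
    have "0 < u" using u(1) by (rule less_le_trans[rotated]) simp
    have "\<lfloor>log 2 u\<rfloor> = int i"
      by (rule floor_unique) (use u \<open>0 < u\<close> in \<open>auto simp: le_log_iff log_less_iff powr_realpow powr_add\<close>)
    then have "k (t + 2 ^ i * a) = i" by (simp add: k_def u_def)
    then show ?thesis by (simp add: G_def)
  qed
qed

text \<open>
  The functions \<open>h k\<close> run through the step functions, each of which occurs for infinitely many \<open>k\<close>
  because the second component of the pair coded by \<open>k\<close> is arbitrary. Values of norm above \<open>k\<close> are set to
  \<open>0\<close>, which does not change a given step function once \<open>k\<close> exceeds its maximal norm.
\<close>

lemma hypercyclic_weighted_translation:
  assumes p: "1 \<le> p" and w: "w > 1" and a: "a > 0"
  shows "hypercyclic (Lp_space half_line p)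
    (weighted_translation p w a :: (real \<Rightarrow> 'k::{real_normed_field, euclidean_space}) set operator)"
    (is "hypercyclic ?X ?T")
proof -
  obtain d :: "nat \<Rightarrow> 'k" where d: "\<And>y e. e > 0 \<Longrightarrow> \<exists>i. norm (d i - y) < e"
    using ex_dense_sequence by blast
  define s where "s k = step_fun d (from_nat (fst (prod_decode k)))" for k
  define h where "h k t = (if norm (s k t) \<le> real k then s k t else 0)" for k t
  have [measurable]: "s k \<in> borel_measurable borel" for k
    unfolding s_def by (rule borel_measurable_step_fun)
  have hm: "h k \<in> borel_measurable borel" for k
    unfolding h_def by measurable
  have "norm (h k t) \<le> real k" for k t by (simp add: h_def)
  from ex_function_with_prescribed_translates[OF a hm this] obtain G
    where Gm: "G \<in> borel_measurable borel" and Gb: "\<And>s. s > 0 \<Longrightarrow> norm (G s) \<le> s / a"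
      and G: "\<And>k t. 0 < t \<Longrightarrow> t < 2 ^ k * a \<Longrightarrow> G (t + 2 ^ k * a) = h k t" by blast
  have "norm (G t) \<le> 1 / a * exp (1 * t)" if "t > 0" for t
  proof -
    have "t \<le> exp t" using exp_ge_add_one_self[of t] by linarith
    then have "t / a \<le> exp t / a" using a by (simp add: divide_right_mono)
    then show ?thesis using Gb[OF that] by simp
  qed
  then have Gt: "exp_bounded G"
    unfolding exp_bounded_def using Gm borel_measurable_half_lineI by blast
  let ?x = "ae_class half_line (gauss_mult w a G)"
  let ?orbit = "range (\<lambda>n. (app ?T ^^ n) ?x)"
  have shift: "exp_bounded (\<lambda>t. G (t + real n * a))" for n using a by (intro exp_bounded_shift[OF Gt]) simp
  have orbit: "(app ?T ^^ n) ?x = ae_class half_line (gauss_mult w a (\<lambda>t. G (t + real n * a)))" for n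
    by (rule weighted_translation_pow_gauss_mult[OF p w a Gt])
  have sub: "?orbit \<subseteq> vcarrier ?X"
    using gauss_mult_in_pow_dom[OF p w a shift, of _ 0] by (auto simp: orbit)
  have dense: "\<exists>n. (LINT t|half_line. norm (f t - gauss_mult w a (\<lambda>t. G (t + real n * a)) t) powr p) < e"
    if f: "p_integrable half_line p f" and e: "e > 0" for f :: "real \<Rightarrow> 'k" and e :: real
  proof -
    have "e / (2 * 2 powr p) > 0" using e by simp
    from gauss_mult_step_fun_dense[OF p w a d f this]
    obtain c where c: "(LINT t|half_line. norm (f t - gauss_mult w a (step_fun d c) t) powr p)
        < e / (2 * 2 powr p)" by blast
    obtain B where B: "B \<ge> 0" "\<And>t. norm (step_fun d c t) \<le> B" using step_fun_bounded[of d c] by blast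
    have st: "exp_bounded (step_fun d c)" by (rule exp_bounded_step_fun)
    \<comment> \<open>Indices at which the step function is listed, large enough that none of its values is cut off.\<close>
    define k where "k n = prod_encode (to_nat c, n + nat \<lceil>B\<rceil>)" for n
    have k: "real n \<le> real (k n)" "B \<le> real (k n)" for n
      using le_prod_encode_2[of "n + nat \<lceil>B\<rceil>" "to_nat c"] by (simp_all add: k_def) linarith+
    have sk: "s (k n) = step_fun d c" for n by (simp add: s_def k_def)
    have hk: "h (k n) t = step_fun d c t" for n t
      unfolding h_def sk using order_trans[OF B(2) k(2)] by (rule if_P)
    have eq: "G (t + real (2 ^ k n) * a) = step_fun d c t" if "0 < t" "t < 2 ^ k n * a" for t n
      using G[OF that] by (simp add: hk)
    have gt: "exp_bounded (\<lambda>t. G (t + real (2 ^ k n) * a))" for n by (rule shift)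
    have lin: "B + 2 / a * t \<le> (B + 2 / a) * exp (1 * t)" if "t > 0" for t
    proof -
      have "B * 1 \<le> B * exp t" using B that by (intro mult_left_mono) auto
      moreover have "2 / a * t \<le> 2 / a * exp t"
        using exp_ge_add_one_self[of t] a by (intro mult_left_mono) (linarith, simp)
      ultimately show ?thesis by (simp add: ring_distribs)
    qed
    have "(\<lambda>n. LINT t|half_line. norm (gauss_mult w a (\<lambda>t. G (t + real (2 ^ k n) * a)) t
        - gauss_mult w a (step_fun d c) t) powr p) \<longlonglongrightarrow> 0"
    proof (rule gauss_mult_dominated_convergence[OF p w a, where K = "B + 2 / a" and c = 1])
      show "(\<lambda>t. G (t + real (2 ^ k n) * a)) \<in> borel_measurable half_line" for n
        using gt by (simp add: exp_bounded_def)
      show "step_fun d c \<in> borel_measurable half_line" using st by (simp add: exp_bounded_def)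
      show "norm (step_fun d c t) \<le> (B + 2 / a) * exp (1 * t)" if "t > 0" for t
        using B(2)[of t] lin[OF that] that a by (intro order_trans[OF _ lin[OF that]]) (auto intro: add_increasing2)
      show "norm (G (t + real (2 ^ k n) * a)) \<le> (B + 2 / a) * exp (1 * t)" if t: "t > 0" for n t
      proof (rule order_trans[OF _ lin[OF t]], cases "t < 2 ^ k n * a")
        case True
        then show "norm (G (t + real (2 ^ k n) * a)) \<le> B + 2 / a * t"
          using B(2)[of t] t a by (simp only: eq) (auto intro: add_increasing2)
      next
        case False
        \<comment> \<open>Beyond the block the shift \<open>2 ^ k n * a\<close> is at most \<open>t\<close>.\<close>
        have "norm (G (t + real (2 ^ k n) * a)) \<le> (t + real (2 ^ k n) * a) / a"
          using t a by (intro Gb) (simp add: add_pos_pos)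
        also have "\<dots> \<le> (t + t) / a" using False a by (intro divide_right_mono) auto
        also have "\<dots> \<le> B + 2 / a * t" using B(1) by simp
        finally show "norm (G (t + real (2 ^ k n) * a)) \<le> B + 2 / a * t" .
      qed
      show "AE t in half_line. (\<lambda>n. G (t + real (2 ^ k n) * a)) \<longlonglongrightarrow> step_fun d c t"
      proof (rule AE_I2)
        fix t :: real assume "t \<in> space half_line"
        then have t: "t > 0" by simp
        have "eventually (\<lambda>n. t / a < real n) sequentially"
          using filterlim_real_sequentially by (simp add: filterlim_at_top_dense)
        then have "eventually (\<lambda>n. G (t + real (2 ^ k n) * a) = step_fun d c t) sequentially"
        proof eventually_elim
          fix n assume "t / a < real n"
          also have "real n \<le> real (k n)" by (rule k)
          also have "\<dots> \<le> 2 ^ k n" using of_nat_less_two_power[of "k n", where 'a = real] by simp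
          finally show "G (t + real (2 ^ k n) * a) = step_fun d c t"
            using t a by (intro eq) (simp_all add: field_simps)
        qed
        then show "(\<lambda>n. G (t + real (2 ^ k n) * a)) \<longlonglongrightarrow> step_fun d c t"
          by (rule tendsto_eventually)
      qed
    qed
    with p obtain n where "(LINT t|half_line.
        norm (f t - gauss_mult w a (\<lambda>t. G (t + real (2 ^ k n) * a)) t) powr p) < e"
      by (elim Lp_approx_trans[OF _ e f p_integrable_gauss_mult[OF p w a st]
        p_integrable_gauss_mult[OF p w a gt] c, rotated]) auto
    then show ?thesis by blast
  qed
  have "dense_in ?X ?orbit"
  proof (rule dense_in_LpI[OF _ sub])
    fix f :: "real \<Rightarrow> 'k" and e :: real assume "p_integrable half_line p f" "e > 0"
    then obtain n where
      n: "(LINT t|half_line. norm (f t - gauss_mult w a (\<lambda>t. G (t + real n * a)) t) powr p) < e"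
      using dense by blast
    show "\<exists>g\<in>borel_measurable half_line. ae_class half_line g \<in> ?orbit
        \<and> (LINT t|half_line. norm (f t - g t) powr p) < e"
    proof (intro bexI conjI)
      show "ae_class half_line (gauss_mult w a (\<lambda>t. G (t + real n * a))) \<in> ?orbit"
        unfolding orbit by (rule rangeI)
      show "gauss_mult w a (\<lambda>t. G (t + real n * a)) \<in> borel_measurable half_line"
        using shift[of n] by (intro borel_measurable_gauss_mult) (simp add: exp_bounded_def)
    qed (rule n)
  qed (use p in simp)
  moreover have "?x \<noteq> vzero ?X"
  proof
    \<comment> \<open>The orbit of \<open>0\<close> would stay at \<open>0\<close>, whose distance from the Gaussian is positive.\<close>
    let ?f = "gauss_mult w a (\<lambda>t. 1 :: 'k)"
    have f: "p_integrable half_line p ?f"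
      by (intro p_integrable_gauss_mult[OF p w a] exp_boundedI[of _ 1]) auto
    have f0: "\<not> (AE t in half_line. ?f t = 0)"
      by (rule gauss_mult_not_AE_0[OF w, of _ 1]) auto
    have fi: "integrable half_line (\<lambda>t. norm (?f t) powr p)"
      using f by (simp add: p_integrable_def)
    have "(LINT t|half_line. norm (?f t) powr p) \<noteq> 0"
      using f0 integral_nonneg_eq_0_iff_AE[OF fi] by simp
    then have "(LINT t|half_line. norm (?f t) powr p) > 0"
      by (simp add: less_le)
    from dense[OF f this] obtain n where
      n: "(LINT t|half_line. norm (?f t - gauss_mult w a (\<lambda>t. G (t + real n * a)) t) powr p)
        < (LINT t|half_line. norm (?f t) powr p)" by blast
    assume "?x = vzero ?X"
    then have "AE t in half_line. gauss_mult w a G t = 0"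
      using Gt by (simp add: Lp_space_def ae_class_eq_iff borel_measurable_gauss_mult exp_bounded_def)
    then have "AE t in half_line. G t = 0" by (simp add: gauss_mult_eq_0_iff[OF w])
    then have "AE t in half_line. G (t + real n * a) = 0"
      by (rule AE_half_line_translate) (use a in simp)
    then have "AE t in half_line. norm (?f t - gauss_mult w a (\<lambda>t. G (t + real n * a)) t) powr p
        = norm (?f t) powr p"
      by eventually_elim (simp add: gauss_mult_def)
    then have "(LINT t|half_line. norm (?f t - gauss_mult w a (\<lambda>t. G (t + real n * a)) t) powr p)
        = (LINT t|half_line. norm (?f t) powr p)"
    proof (rule integral_cong_AE[rotated 2])
      have [measurable]: "?f \<in> borel_measurable half_line"
        "gauss_mult w a (\<lambda>t. G (t + real n * a)) \<in> borel_measurable half_line"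
        using shift[of n] by (auto intro!: borel_measurable_gauss_mult simp: exp_bounded_def)
      show "(\<lambda>t. norm (?f t - gauss_mult w a (\<lambda>t. G (t + real n * a)) t) powr p)
          \<in> borel_measurable half_line" by measurable
      show "(\<lambda>t. norm (?f t) powr p) \<in> borel_measurable half_line" by measurable
    qed
    with n show False by simp
  qed
  ultimately show ?thesis
    using gauss_mult_in_pow_dom[OF p w a Gt]
    unfolding hypercyclic_def hypercyclic_vector_def C_infinity_def by blast
qed

section \<open>Chaos and spectrum\<close>

lemma point_spectrum_subset_spectrum: "point_spectrum X T \<subseteq> spectrum X T"
  unfolding point_spectrum_def spectrum_def resolvent_set_def
  by (auto intro: inj_on_inverseI)

theorem theorem4p1:
  fixes p w a :: real
  assumes "1 \<le> p" and "w > 1" and "a > 0"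
  shows "unbounded_linear_operator (Lp_real p) (weighted_translation p w a)
       \<and> chaotic (Lp_real p) (weighted_translation p w a)
       \<and> unbounded_linear_operator (Lp_complex p) (weighted_translation p w a)
       \<and> chaotic (Lp_complex p) (weighted_translation p w a)
       \<and> spectrum (Lp_complex p) (weighted_translation p w a) = UNIV
       \<and> point_spectrum (Lp_complex p) (weighted_translation p w a) = UNIV"
  using point_spectrum_subset_spectrum[of "Lp_complex p" "weighted_translation p w a"]
  unfolding chaotic_def
  by (auto simp: point_spectrum_weighted_translation[OF assms]
      intro: weighted_translation_unbounded[OF assms] hypercyclic_weighted_translation[OF assms]
        periodic_points_dense[OF assms])

end
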